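(* For $n\in\mathbb N$ let $\mu_n=\sum_{x\in\mathbb Z}\delta_{(n^{-\zeta}x,\;n^{1-\zeta}d(x))}$, a point process on $\mathbb R\times(0,\infty)$. As $n\to\infty$, $\mu_n$ converges in distribution, with respect to the vague topology, to the Poisson point process $\mu$ on $\mathbb R\times(0,\infty)$ with intensity function \[ (x,y)\mapsto q^2p_\kappa\,y^{2\kappa+1},\qquad p_\kappa=2\,\mathfrak B(\kappa+1,\kappa+1), \] where $\mathfrak B$ is the Euler beta function.
   Context: Let $c>0$, $q>0$, $\kappa>-1$. $F=(F(x))_{x\in\mathbb Z}$ is a family of i.i.d. random variables whose common density $\varrho$ is even, continuous, strictly positive on $(-c,c)$, zero outside $(-c,c)$, with $\lim_{x\to c}\varrho(x)/|c-x|^{\kappa}=q$. The discrepancy of the edge $\{x,x+1\}$ is $d(x)=2c-|F(x+1)-F(x)|$. Let $\zeta=\frac{2\kappa+2}{2\kappa+3}$. *)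

theory Defs
  imports "HOL-Probability.Probability"
begin

definition Espace :: "(real \<times> real) set" where
  "Espace = UNIV \<times> {0<..}"

definition Cc_plus :: "((real \<times> real) \<Rightarrow> real) set" where
  "Cc_plus = {f. continuous_on UNIV f \<and> (\<forall>z. 0 \<le> f z) \<and>
      (\<exists>K. compact K \<and> K \<subseteq> Espace \<and> (\<forall>z. z \<notin> K \<longrightarrow> f z = 0))}"

definition LFmeasures :: "(real \<times> real) measure set" where
  "LFmeasures = {m. sets m = sets borel \<and> emeasure m (- Espace) = 0 \<and>
      (\<forall>K. compact K \<and> K \<subseteq> Espace \<longrightarrow> emeasure m K < \<infinity>)}"

definition vague_topology :: "(real \<times> real) measure topology" where
  "vague_topology = subtopology
     (topology_generated_by
        {{m. (\<integral>\<^sup>+ z. ennreal (f z) \<partial>m) \<in> U} | f U. f \<in> Cc_plus \<and> open U})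
     LFmeasures"

definition conv_distr_vague ::
  "'a measure \<Rightarrow> (nat \<Rightarrow> 'a \<Rightarrow> (real \<times> real) measure) \<Rightarrow>
   'b measure \<Rightarrow> ('b \<Rightarrow> (real \<times> real) measure) \<Rightarrow> bool" where
  "conv_distr_vague M X N Y \<longleftrightarrow>
     (\<forall>g :: (real \<times> real) measure \<Rightarrow> real.
        continuous_map vague_topology euclidean g \<and> bounded (g ` LFmeasures) \<longrightarrow>
        (\<lambda>n. integral\<^sup>L M (\<lambda>\<omega>. g (X n \<omega>))) \<longlonglongrightarrow> integral\<^sup>L N (\<lambda>\<omega>. g (Y \<omega>)))"

definition Ebounded :: "(real \<times> real) set \<Rightarrow> bool" where
  "Ebounded B \<longleftrightarrow> B \<in> sets borel \<and> (\<exists>K. compact K \<and> K \<subseteq> Espace \<and> B \<subseteq> K)"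

definition intensity :: "((real \<times> real) \<Rightarrow> real) \<Rightarrow> (real \<times> real) set \<Rightarrow> real" where
  "intensity lam B = enn2real (\<integral>\<^sup>+ z \<in> B. ennreal (lam z) \<partial>lborel)"

definition poisson_process ::
  "'b measure \<Rightarrow> ('b \<Rightarrow> (real \<times> real) measure) \<Rightarrow> ((real \<times> real) \<Rightarrow> real) \<Rightarrow> bool" where
  "poisson_process N Y lam \<longleftrightarrow>
     prob_space N \<and> (\<forall>\<omega>\<in>space N. Y \<omega> \<in> LFmeasures) \<and>
     (\<forall>B. Ebounded B \<longrightarrow>
        (\<forall>k::nat. measure N {\<omega> \<in> space N. emeasure (Y \<omega>) B = of_nat k}
            = intensity lam B ^ k / fact k * exp (- intensity lam B))) \<and>
     (\<forall>(B :: nat \<Rightarrow> (real \<times> real) set) I. finite I \<and> disjoint_family_on B I \<and>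
        (\<forall>i\<in>I. Ebounded (B i)) \<longrightarrow>
        prob_space.indep_vars N (\<lambda>_. borel) (\<lambda>i \<omega>. emeasure (Y \<omega>) (B i)) I)"

definition discrepancy :: "real \<Rightarrow> (int \<Rightarrow> 'a \<Rightarrow> real) \<Rightarrow> 'a \<Rightarrow> int \<Rightarrow> real" where
  "discrepancy c F \<omega> x = 2 * c - \<bar>F (x + 1) \<omega> - F x \<omega>\<bar>"

text \<open>The rescaled point process mu_n = sum over x in Z of the Dirac mass at
  (n^(-zeta) x, n^(1-zeta) d(x)), restricted to E (points outside E occur with
  probability zero).\<close>
definition rescaled_pp ::
  "real \<Rightarrow> real \<Rightarrow> (int \<Rightarrow> 'a \<Rightarrow> real) \<Rightarrow> nat \<Rightarrow> 'a \<Rightarrow> (real \<times> real) measure" where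
  "rescaled_pp c \<zeta> F n \<omega> =
     (let pt = (\<lambda>x::int. (real n powr (- \<zeta>) * real_of_int x,
                          real n powr (1 - \<zeta>) * discrepancy c F \<omega> x))
      in distr (count_space {x. pt x \<in> Espace}) borel pt)"

end

theory Submission
  imports Defs
begin

text \<open>
  A vaguely open set is an increasing union of sets described by the masses of finitely many
  half-open dyadic cells, so weak convergence needs only a lower bound on the limit inferior of the
  probabilities of such sets, and no tightness. Cutting the cells into thin vertical strips makes
  multiple points in a strip unlikely, so the masses are determined by the set of occupied strips,
  and the law of that set is determined by void probabilities through inclusion and exclusion.
  Convergence to a Poisson process thus follows from convergence of void probabilities and means.
  The discrepancies are one-dependent and two neighbouring ones are rarely both small, so void
  probabilities are asymptotically the exponential of minus the mean. Finally, a small discrepancy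
  means that two neighbouring values lie near opposite edges $\pm c$, and the integral of
  $u^\kappa v^\kappa$ over $u + v < \varepsilon$ produces the Beta function and the intensity.
\<close>

section \<open>Grid cells\<close>

definition grid_cell :: "nat \<Rightarrow> nat \<Rightarrow> int \<times> int \<Rightarrow> (real \<times> real) set" where
  "grid_cell a b k = {z. \<lfloor>real a * fst z\<rfloor> = fst k \<and> \<lfloor>real b * snd z\<rfloor> = snd k}"

definition refine_idx :: "nat \<Rightarrow> nat \<Rightarrow> int \<times> int \<Rightarrow> (int \<times> int) set" where
  "refine_idx K L k =
     {fst k * int K..<(fst k + 1) * int K} \<times> {snd k * int L..<(snd k + 1) * int L}"

lemma finite_refine_idx [simp]: "finite (refine_idx K L k)"
  by (simp add: refine_idx_def)

lemma card_refine_idx: "card (refine_idx K L k) = K * L"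
  by (simp add: refine_idx_def card_cartesian_product ring_distribs)

lemma snd_refine_idx_ge_1:
  assumes "k' \<in> refine_idx K L k" "snd k \<ge> 1" "L > 0"
  shows "snd k' \<ge> 1"
proof -
  have "1 * 1 \<le> snd k * int L"
    using assms by (intro mult_mono) auto
  with assms(1) show ?thesis
    by (auto simp: refine_idx_def)
qed

lemma floor_mult_in_block_iff:
  assumes "K > 0"
  shows "\<lfloor>real (a * K) * x\<rfloor> \<in> {i * int K..<(i + 1) * int K} \<longleftrightarrow> \<lfloor>real a * x\<rfloor> = i"
proof -
  have "real (a * K) * x = real a * x * real K"
    by simp
  moreover have "real_of_int (i * int K) \<le> real a * x * real K \<longleftrightarrow> real_of_int i \<le> real a * x"
    "real a * x * real K < real_of_int ((i + 1) * int K) \<longleftrightarrow> real a * x < real_of_int i + 1"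
    using assms by simp_all
  ultimately show ?thesis
    by (auto simp only: atLeastLessThan_iff le_floor_iff floor_less_iff floor_eq_iff)
qed

lemma grid_cell_refine:
  assumes "K > 0" "L > 0"
  shows "grid_cell a b k = (\<Union>k'\<in>refine_idx K L k. grid_cell (a * K) (b * L) k')"
  unfolding grid_cell_def refine_idx_def
    floor_mult_in_block_iff[OF assms(1), of a, symmetric]
    floor_mult_in_block_iff[OF assms(2), of b, symmetric]
  by force

lemma disjoint_grid_cell: "disjoint_family_on (grid_cell a b) A"
  unfolding disjoint_family_on_def grid_cell_def by (auto simp: prod_eq_iff)

lemma grid_cell_eq_Times:
  assumes "a > 0" "b > 0"
  shows "grid_cell a b k = {real_of_int (fst k) / real a..<(real_of_int (fst k) + 1) / real a}
    \<times> {real_of_int (snd k) / real b..<(real_of_int (snd k) + 1) / real b}"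
  using assms unfolding grid_cell_def by (auto simp: floor_eq_iff field_simps)

lemma sets_grid_cell [measurable]: "grid_cell a b k \<in> sets borel"
proof -
  have "{z \<in> space (borel \<Otimes>\<^sub>M borel). \<lfloor>real a * fst z\<rfloor> = fst k \<and> \<lfloor>real b * snd z\<rfloor> = snd k}
      \<in> sets (borel \<Otimes>\<^sub>M borel)"
    by measurable
  then show ?thesis
    unfolding grid_cell_def borel_prod by simp
qed

lemma Ebounded_subset: "Ebounded B \<Longrightarrow> A \<subseteq> B \<Longrightarrow> A \<in> sets borel \<Longrightarrow> Ebounded A"
  unfolding Ebounded_def by blast

lemma Ebounded_compact: "compact K \<Longrightarrow> K \<subseteq> Espace \<Longrightarrow> Ebounded K"
  unfolding Ebounded_def by (auto simp: compact_imp_closed)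

lemma Ebounded_rectangle: "0 < s \<Longrightarrow> Ebounded ({u..v} \<times> {s..t})"
  by (rule Ebounded_compact) (auto simp: Espace_def intro: compact_Times)

lemma Ebounded_grid_cell:
  assumes "a > 0" "b > 0" "snd k \<ge> 1"
  shows "Ebounded (grid_cell a b k)"
proof (rule Ebounded_subset)
  show "Ebounded ({real_of_int (fst k) / real a..(real_of_int (fst k) + 1) / real a}
    \<times> {real_of_int (snd k) / real b..(real_of_int (snd k) + 1) / real b})"
    using assms by (intro Ebounded_rectangle) simp
  show "grid_cell a b k \<subseteq> {real_of_int (fst k) / real a..(real_of_int (fst k) + 1) / real a}
    \<times> {real_of_int (snd k) / real b..(real_of_int (snd k) + 1) / real b}"
    using grid_cell_eq_Times[OF assms(1,2)] by auto
qed (rule sets_grid_cell)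

lemma Ebounded_UN:
  assumes "finite A" "\<And>k. k \<in> A \<Longrightarrow> Ebounded (B k)"
  shows "Ebounded (\<Union>k\<in>A. B k)"
proof -
  obtain K where K: "\<And>k. k \<in> A \<Longrightarrow> compact (K k) \<and> K k \<subseteq> Espace \<and> B k \<subseteq> K k"
    using assms(2) unfolding Ebounded_def by metis
  show ?thesis
  proof (rule Ebounded_subset)
    show "Ebounded (\<Union>k\<in>A. K k)"
      using K assms(1) by (intro Ebounded_compact compact_UN) auto
    show "(\<Union>k\<in>A. B k) \<in> sets borel"
      using assms by (intro sets.finite_UN) (auto simp: Ebounded_def)
  qed (use K in blast)
qed

lemma sets_LFmeasures: "m \<in> LFmeasures \<Longrightarrow> sets m = sets borel"
  by (simp add: LFmeasures_def)

lemma borel_measurable_LFmeasures: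
  "m \<in> LFmeasures \<Longrightarrow> f \<in> borel_measurable borel \<Longrightarrow> f \<in> borel_measurable m"
  using measurable_cong_sets[OF sets_LFmeasures refl] by blast

lemma emeasure_Ebounded_finite:
  assumes "m \<in> LFmeasures" "Ebounded B"
  shows "emeasure m B < \<infinity>"
proof -
  obtain K where K: "compact K" "K \<subseteq> Espace" "B \<subseteq> K"
    using assms(2) unfolding Ebounded_def by blast
  have "emeasure m B \<le> emeasure m K"
    using K(1,3) sets_LFmeasures[OF assms(1)] by (intro emeasure_mono) (auto simp: compact_imp_closed)
  also have "\<dots> < \<infinity>"
    using assms(1) K unfolding LFmeasures_def by blast
  finally show ?thesis .
qed

lemma integrable_indicator_Ebounded:
  assumes "m \<in> LFmeasures" "Ebounded B"
  shows "integrable m (indicator B :: _ \<Rightarrow> real)"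
  using emeasure_Ebounded_finite[OF assms] assms sets_LFmeasures[of m]
  by (intro integrable_real_indicator) (auto simp: Ebounded_def)

lemma space_LFmeasures: "m \<in> LFmeasures \<Longrightarrow> space m = UNIV"
  using sets_eq_imp_space_eq[OF sets_LFmeasures] by simp

lemma measure_UN_grid_cells:
  assumes "m \<in> LFmeasures" "a > 0" "b > 0" "finite A" "\<And>k. k \<in> A \<Longrightarrow> snd k \<ge> 1"
  shows "measure m (\<Union>k\<in>A. grid_cell a b k) = (\<Sum>k\<in>A. measure m (grid_cell a b k))"
proof (rule measure_finite_Union[OF \<open>finite A\<close>])
  show "emeasure m (grid_cell a b k) \<noteq> \<infinity>" if "k \<in> A" for k
    using emeasure_Ebounded_finite[OF assms(1) Ebounded_grid_cell[OF assms(2,3) assms(5)[OF that]]]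
    by simp
qed (use sets_LFmeasures[OF assms(1)] disjoint_grid_cell in auto)

lemma measure_grid_cell_refine:
  assumes "m \<in> LFmeasures" "K > 0" "L > 0" "a > 0" "b > 0" "snd k \<ge> 1"
  shows "measure m (grid_cell a b k)
    = (\<Sum>k'\<in>refine_idx K L k. measure m (grid_cell (a * K) (b * L) k'))"
  unfolding grid_cell_refine[OF assms(2,3), of a b k]
  using assms snd_refine_idx_ge_1 by (intro measure_UN_grid_cells) auto

section \<open>Dyadic cells determine the vague topology\<close>

abbreviation dyadic_cell :: "nat \<Rightarrow> int \<times> int \<Rightarrow> (real \<times> real) set" where
  "dyadic_cell r \<equiv> grid_cell (2 ^ r) (2 ^ r)"

definition window :: "nat \<Rightarrow> (int \<times> int) set" where
  "window r = {- (int r * 2 ^ r)..<int r * 2 ^ r} \<times> {1..<int r * 2 ^ r}"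

definition dyadic_box :: "nat \<Rightarrow> (real \<times> real) set" where
  "dyadic_box r = {- real r..<real r} \<times> {1 / 2 ^ r..<real r}"

definition corner :: "nat \<Rightarrow> int \<times> int \<Rightarrow> real \<times> real" where
  "corner r k = (real_of_int (fst k) / 2 ^ r, real_of_int (snd k) / 2 ^ r)"

lemma finite_window [simp]: "finite (window r)"
  by (simp add: window_def)

lemma window_snd_ge_1: "k \<in> window r \<Longrightarrow> snd k \<ge> 1"
  by (auto simp: window_def)

lemma corner_in_dyadic_cell: "corner r k \<in> dyadic_cell r k"
  by (simp add: corner_def grid_cell_def)

lemma dyadic_cell_index_in_window_iff:
  assumes "z \<in> dyadic_cell r k"
  shows "k \<in> window r \<longleftrightarrow> z \<in> dyadic_box r"
proof -
  have k: "fst k = \<lfloor>2 ^ r * fst z\<rfloor>" "snd k = \<lfloor>2 ^ r * snd z\<rfloor>"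
    using assms by (auto simp: grid_cell_def)
  have "- (int r * 2 ^ r) \<le> fst k \<longleftrightarrow> - real r \<le> fst z" "fst k < int r * 2 ^ r \<longleftrightarrow> fst z < real r"
    "1 \<le> snd k \<longleftrightarrow> 1 / 2 ^ r \<le> snd z" "snd k < int r * 2 ^ r \<longleftrightarrow> snd z < real r"
    unfolding k by (simp_all add: le_floor_iff floor_less_iff field_simps)
      (metis minus_mult_right mult.commute mult_le_cancel_left_pos zero_less_numeral zero_less_power)
  then show ?thesis
    by (auto simp: window_def dyadic_box_def mem_Times_iff)
qed

lemma UN_dyadic_cells: "(\<Union>k\<in>window r. dyadic_cell r k) = dyadic_box r"
proof (intro set_eqI iffI)
  fix z assume "z \<in> dyadic_box r"
  moreover have "z \<in> dyadic_cell r (\<lfloor>2 ^ r * fst z\<rfloor>, \<lfloor>2 ^ r * snd z\<rfloor>)"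
    by (simp add: grid_cell_def)
  ultimately show "z \<in> (\<Union>k\<in>window r. dyadic_cell r k)"
    using dyadic_cell_index_in_window_iff by blast
qed (use dyadic_cell_index_in_window_iff in blast)

lemma Ebounded_dyadic_box: "Ebounded (dyadic_box r)"
  unfolding UN_dyadic_cells[symmetric]
  by (intro Ebounded_UN Ebounded_grid_cell) (auto dest: window_snd_ge_1)

lemma dyadic_box_mono:
  assumes "r \<le> r'"
  shows "dyadic_box r \<subseteq> dyadic_box r'"
proof -
  have "1 / 2 ^ r' \<le> (1 / 2 ^ r :: real)"
    using assms by (intro divide_left_mono power_increasing) auto
  then show ?thesis
    using assms by (auto simp: dyadic_box_def)
qed

lemma compact_subset_dyadic_box:
  assumes "compact K" "K \<subseteq> Espace"
  shows "\<exists>r. K \<subseteq> dyadic_box r"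
proof (cases "K = {}")
  case False
  obtain z0 where z0: "z0 \<in> K" "\<And>z. z \<in> K \<Longrightarrow> snd z0 \<le> snd z"
    using continuous_attains_inf[OF assms(1) False continuous_on_snd[OF continuous_on_id]] by auto
  obtain B where B: "\<And>z. z \<in> K \<Longrightarrow> norm z \<le> B"
    using compact_imp_bounded[OF assms(1)] by (auto simp: bounded_iff)
  have "snd z0 > 0"
    using z0(1) assms(2) by (auto simp: Espace_def)
  then obtain r1 where r1: "(1 / 2 :: real) ^ r1 < snd z0"
    using real_arch_pow_inv[of "snd z0" "1 / 2"] by auto
  obtain r2 where r2: "B < real r2"
    using reals_Archimedean2 by blast
  have "(1 / 2 :: real) ^ max r1 r2 \<le> (1 / 2) ^ r1"
    by (intro power_decreasing) auto
  then have low: "1 / 2 ^ max r1 r2 \<le> snd z" if "z \<in> K" for z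
    using r1 z0(2)[OF that] by (simp add: power_one_over)
  have "\<bar>fst z\<bar> < real (max r1 r2)" "\<bar>snd z\<bar> < real (max r1 r2)" if "z \<in> K" for z
    using B[OF that] r2 norm_fst_le[of "fst z" "snd z"] norm_snd_le[of "snd z" "fst z"] by auto
  with low have "K \<subseteq> dyadic_box (max r1 r2)"
    by (fastforce simp: dyadic_box_def mem_Times_iff)
  then show ?thesis ..
qed auto

lemma dyadic_cell_add_refine:
  "dyadic_cell r k = (\<Union>k'\<in>refine_idx (2 ^ s) (2 ^ s) k. dyadic_cell (r + s) k')"
  using grid_cell_refine[of "2 ^ s" "2 ^ s" "2 ^ r" "2 ^ r" k] by (simp add: power_add)

lemma refine_window:
  assumes "k \<in> window r" "k' \<in> refine_idx (2 ^ s) (2 ^ s) k"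
  shows "k' \<in> window (r + s)"
proof -
  have "corner (r + s) k' \<in> dyadic_cell r k"
    using assms(2) corner_in_dyadic_cell dyadic_cell_add_refine by blast
  then have "corner (r + s) k' \<in> dyadic_box (r + s)"
    using assms(1) dyadic_cell_index_in_window_iff dyadic_box_mono[of r "r + s"] by auto
  then show ?thesis
    using dyadic_cell_index_in_window_iff[OF corner_in_dyadic_cell] by simp
qed

lemma dyadic_box_saturated:
  assumes "z \<in> dyadic_cell (r + s) k" "z' \<in> dyadic_cell (r + s) k"
  shows "z \<in> dyadic_box r \<longleftrightarrow> z' \<in> dyadic_box r"
proof -
  have "z' \<in> dyadic_cell r l \<longleftrightarrow> z \<in> dyadic_cell r l" for l
    using assms unfolding dyadic_cell_add_refine[of r l s] by (simp add: grid_cell_def)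
  then show ?thesis
    unfolding UN_dyadic_cells[symmetric] by simp
qed

lemma dist_dyadic_cell:
  assumes "z \<in> dyadic_cell r k" "z' \<in> dyadic_cell r k"
  shows "dist z z' < 2 * (1 / 2) ^ r"
proof -
  have floor_close: "\<bar>u - v\<bar> < (1 / 2) ^ r" if "\<lfloor>2 ^ r * u\<rfloor> = \<lfloor>2 ^ r * v\<rfloor>" for u v :: real
  proof -
    have "2 ^ r * \<bar>u - v\<bar> = \<bar>2 ^ r * u - 2 ^ r * v\<bar>"
      by (simp add: abs_mult flip: right_diff_distrib)
    also have "\<dots> < 1"
      using that by linarith
    finally show ?thesis
      by (simp add: power_divide field_simps)
  qed
  have "dist z z' \<le> dist (fst z) (fst z') + dist (snd z) (snd z')"
    unfolding dist_prod_def by (rule sqrt_sum_squares_le_sum) auto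
  also have "\<dots> < (1 / 2) ^ r + (1 / 2) ^ r"
    using assms unfolding grid_cell_def dist_real_def by (intro add_strict_mono floor_close) auto
  finally show ?thesis
    by simp
qed

definition cell_masses :: "nat \<Rightarrow> (real \<times> real) measure \<Rightarrow> int \<times> int \<Rightarrow> real" where
  "cell_masses r m k = (if k \<in> window r then measure m (dyadic_cell r k) else 0)"

definition coarsen :: "nat \<Rightarrow> nat \<Rightarrow> (int \<times> int \<Rightarrow> real) \<Rightarrow> int \<times> int \<Rightarrow> real" where
  "coarsen r s \<phi> k =
     (if k \<in> window r then \<Sum>k'\<in>refine_idx (2 ^ s) (2 ^ s) k. \<phi> k' else 0)"

lemma coarsen_cell_masses:
  assumes "m \<in> LFmeasures"
  shows "coarsen r s (cell_masses (r + s) m) = cell_masses r m"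
proof
  fix k
  show "coarsen r s (cell_masses (r + s) m) k = cell_masses r m k"
    using measure_grid_cell_refine[OF assms, of "2 ^ s" "2 ^ s" "2 ^ r" "2 ^ r" k]
      refine_window[of k r _ s] window_snd_ge_1[of k r]
    by (auto simp: coarsen_def cell_masses_def power_add intro!: sum.cong)
qed

lemma continuous_on_coarsen: "continuous_on UNIV (coarsen r s)"
proof (rule continuous_on_coordinatewise_then_product)
  fix k
  show "continuous_on UNIV (\<lambda>\<phi>. coarsen r s \<phi> k)"
    unfolding coarsen_def
    by (cases "k \<in> window r") (auto intro!: continuous_intros continuous_on_product_coordinates)
qed

lemma measure_dyadic_box:
  assumes "m \<in> LFmeasures"
  shows "measure m (dyadic_box r) = (\<Sum>k\<in>window r. cell_masses r m k)"
  unfolding UN_dyadic_cells[symmetric] cell_masses_def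
  using assms window_snd_ge_1 by (subst measure_UN_grid_cells) auto

definition mass_interior :: "nat \<Rightarrow> (real \<times> real) measure set \<Rightarrow> (int \<times> int \<Rightarrow> real) set" where
  "mass_interior r G =
     \<Union>{U. open U \<and> (\<forall>m\<in>LFmeasures. cell_masses r m \<in> U \<longrightarrow> m \<in> G)}"

lemma open_mass_interior: "open (mass_interior r G)"
  unfolding mass_interior_def by blast

lemma mass_interiorI:
  assumes "open U" "\<phi> \<in> U" "\<And>m. m \<in> LFmeasures \<Longrightarrow> cell_masses r m \<in> U \<Longrightarrow> m \<in> G"
  shows "\<phi> \<in> mass_interior r G"
  using assms unfolding mass_interior_def by blast

lemma mass_interior_imp: "m \<in> LFmeasures \<Longrightarrow> cell_masses r m \<in> mass_interior r G \<Longrightarrow> m \<in> G"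
  unfolding mass_interior_def by blast

lemma mass_interior_Int: "mass_interior r G \<inter> mass_interior r H \<subseteq> mass_interior r (G \<inter> H)"
proof
  fix \<phi> assume "\<phi> \<in> mass_interior r G \<inter> mass_interior r H"
  then show "\<phi> \<in> mass_interior r (G \<inter> H)"
    by (intro mass_interiorI[of "mass_interior r G \<inter> mass_interior r H"])
      (auto intro: open_Int open_mass_interior mass_interior_imp)
qed

lemma mass_interior_mono: "G \<inter> LFmeasures \<subseteq> H \<Longrightarrow> mass_interior r G \<subseteq> mass_interior r H"
  unfolding mass_interior_def by blast

lemma mass_interior_add:
  assumes "m \<in> LFmeasures" "cell_masses r m \<in> mass_interior r G"
  shows "cell_masses (r + s) m \<in> mass_interior (r + s) G"
proof (rule mass_interiorI)
  show "open (coarsen r s -` mass_interior r G)"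
    by (rule open_vimage[OF open_mass_interior continuous_on_coarsen])
qed (use assms mass_interior_imp in \<open>auto simp: coarsen_cell_masses\<close>)

lemma Cc_plus_continuous: "f \<in> Cc_plus \<Longrightarrow> continuous_on UNIV f"
  by (simp add: Cc_plus_def)

lemma Cc_plus_boundedE:
  assumes "f \<in> Cc_plus"
  obtains B r where "\<And>z. \<bar>f z\<bar> \<le> B * indicator (dyadic_box r) z"
proof -
  obtain K where K: "compact K" "K \<subseteq> Espace" "\<And>z. z \<notin> K \<Longrightarrow> f z = 0"
    using assms unfolding Cc_plus_def by auto
  obtain r where r: "K \<subseteq> dyadic_box r"
    using compact_subset_dyadic_box[OF K(1,2)] by blast
  have "bounded (f ` K)"
    using continuous_on_subset[OF Cc_plus_continuous[OF assms]] K(1)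
    by (intro compact_imp_bounded compact_continuous_image) auto
  then obtain B where "\<And>z. z \<in> K \<Longrightarrow> \<bar>f z\<bar> \<le> B"
    unfolding bounded_iff by auto
  then have "\<bar>f z\<bar> \<le> \<bar>B\<bar> * indicator (dyadic_box r) z" for z
    using r K(3)[of z] order_trans[OF _ abs_ge_self[of B], of "\<bar>f z\<bar>"] by (cases "z \<in> K") auto
  then show ?thesis
    using that by blast
qed

lemma Cc_plus_integrable:
  assumes "f \<in> Cc_plus" "m \<in> LFmeasures"
  shows "integrable m f"
proof -
  obtain B r where B: "\<And>z. \<bar>f z\<bar> \<le> B * indicator (dyadic_box r) z"
    using Cc_plus_boundedE[OF assms(1)] by blast
  show ?thesis
  proof (rule Bochner_Integration.integrable_bound)
    show "integrable m (\<lambda>z. B * indicator (dyadic_box r) z)"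
      by (intro integrable_mult_right integrable_indicator_Ebounded assms(2) Ebounded_dyadic_box)
    show "f \<in> borel_measurable m"
      by (rule borel_measurable_LFmeasures[OF assms(2) borel_measurable_continuous_onI])
        (rule Cc_plus_continuous[OF assms(1)])
    show "AE z in m. norm (f z) \<le> norm (B * indicator (dyadic_box r) z)"
      using B by (intro AE_I2) (simp add: order_trans[OF _ abs_ge_self])
  qed
qed

lemma Cc_plus_uniformly_continuous:
  assumes "f \<in> Cc_plus"
  shows "uniformly_continuous_on (dyadic_box r) f"
proof -
  have "dyadic_box r \<subseteq> {- real r..real r} \<times> {1 / 2 ^ r..real r}"
    by (auto simp: dyadic_box_def)
  moreover have "uniformly_continuous_on ({- real r..real r} \<times> {1 / 2 ^ r..real r}) f"
    using continuous_on_subset[OF Cc_plus_continuous[OF assms]]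
    by (intro compact_uniformly_continuous compact_Times) auto
  ultimately show ?thesis
    unfolding uniformly_continuous_on_def by (meson subsetD)
qed

definition dyadic_step :: "nat \<Rightarrow> (real \<times> real \<Rightarrow> real) \<Rightarrow> real \<times> real \<Rightarrow> real" where
  "dyadic_step r f z = (\<Sum>k\<in>window r. f (corner r k) * indicator (dyadic_cell r k) z)"

lemma dyadic_step_in_cell:
  assumes "k \<in> window r" "z \<in> dyadic_cell r k"
  shows "dyadic_step r f z = f (corner r k)"
proof -
  have "dyadic_step r f z = (\<Sum>l\<in>window r. if l = k then f (corner r k) else 0)"
    unfolding dyadic_step_def using assms(2)
    by (intro sum.cong) (auto simp: grid_cell_def indicator_def prod_eq_iff)
  then show ?thesis
    using assms(1) by simp
qed

lemma dyadic_step_outside: "z \<notin> dyadic_box r \<Longrightarrow> dyadic_step r f z = 0"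
  unfolding dyadic_step_def UN_dyadic_cells[symmetric] by (auto intro!: sum.neutral)

lemma dyadic_step_approx:
  assumes f: "f \<in> Cc_plus" and support: "\<And>z. z \<notin> dyadic_box r \<Longrightarrow> f z = 0" and \<eta>: "\<eta> > 0"
  shows "\<exists>s. \<forall>z. \<bar>f z - dyadic_step (r + s) f z\<bar> \<le> \<eta> * indicator (dyadic_box r) z"
proof -
  obtain \<delta> where \<delta>: "\<delta> > 0"
    "\<And>z z'. z \<in> dyadic_box r \<Longrightarrow> z' \<in> dyadic_box r \<Longrightarrow> dist z' z < \<delta> \<Longrightarrow> dist (f z') (f z) < \<eta>"
    using Cc_plus_uniformly_continuous[OF f] \<eta> unfolding uniformly_continuous_on_def by metis
  obtain s where s: "(1 / 2 :: real) ^ s < \<delta> / 2"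
    using real_arch_pow_inv[of "\<delta> / 2" "1 / 2"] \<delta>(1) by auto
  have "(1 / 2 :: real) ^ (r + s) \<le> (1 / 2) ^ s"
    by (intro power_decreasing) auto
  with s have mesh: "2 * (1 / 2 :: real) ^ (r + s) < \<delta>"
    by linarith
  have "\<bar>f z - dyadic_step (r + s) f z\<bar> \<le> \<eta> * indicator (dyadic_box r) z" for z
  proof (cases "z \<in> dyadic_box (r + s)")
    case True
    then obtain k where k: "k \<in> window (r + s)" "z \<in> dyadic_cell (r + s) k"
      unfolding UN_dyadic_cells[symmetric] by blast
    note saturated = dyadic_box_saturated[OF k(2) corner_in_dyadic_cell]
    have "dist (f z) (f (corner (r + s) k)) < \<eta>" if "z \<in> dyadic_box r"
      using dist_dyadic_cell[OF k(2) corner_in_dyadic_cell] mesh that saturated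
      by (intro \<delta>(2)) auto
    then show ?thesis
      using support saturated
      by (auto simp: dyadic_step_in_cell[OF k] dist_real_def indicator_def)
  next
    case False
    then have "z \<notin> dyadic_box r"
      using dyadic_box_mono[of r "r + s"] by auto
    then show ?thesis
      using False by (simp add: support dyadic_step_outside)
  qed
  then show ?thesis
    by blast
qed

definition step_integral :: "nat \<Rightarrow> (real \<times> real \<Rightarrow> real) \<Rightarrow> (int \<times> int \<Rightarrow> real) \<Rightarrow> real" where
  "step_integral r f \<phi> = (\<Sum>k\<in>window r. f (corner r k) * \<phi> k)"

lemma continuous_on_step_integral: "continuous_on UNIV (step_integral r f)"
  unfolding step_integral_def by (intro continuous_intros continuous_on_product_coordinates)

text \<open>The cells are half open, so the integral of the step function depends on a measure through its
  cell masses only, and no cell boundary has to be a null set.\<close>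

lemma integral_dyadic_step_approx:
  assumes "f \<in> Cc_plus" "m \<in> LFmeasures"
    and approx: "\<And>z. \<bar>f z - dyadic_step r f z\<bar> \<le> \<eta> * indicator (dyadic_box s) z"
  shows "\<bar>integral\<^sup>L m f - step_integral r f (cell_masses r m)\<bar> \<le> \<eta> * measure m (dyadic_box s)"
proof -
  have cell: "Ebounded (dyadic_cell r k)" if "k \<in> window r" for k
    using window_snd_ge_1[OF that] by (intro Ebounded_grid_cell) auto
  have step: "integrable m (dyadic_step r f)"
    unfolding dyadic_step_def using cell assms(2)
    by (intro Bochner_Integration.integrable_sum integrable_mult_right integrable_indicator_Ebounded)
  have "integral\<^sup>L m (dyadic_step r f) = step_integral r f (cell_masses r m)"
    unfolding dyadic_step_def step_integral_def using assms(2) cell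
    by (subst Bochner_Integration.integral_sum)
      (simp_all add: integrable_indicator_Ebounded space_LFmeasures cell_masses_def)
  then have "\<bar>integral\<^sup>L m f - step_integral r f (cell_masses r m)\<bar>
      = \<bar>\<integral>z. f z - dyadic_step r f z \<partial>m\<bar>"
    using Cc_plus_integrable[OF assms(1,2)] step by simp
  also have "\<dots> \<le> (\<integral>z. \<eta> * indicator (dyadic_box s) z \<partial>m)"
    using Cc_plus_integrable[OF assms(1,2)] step approx
    by (intro order_trans[OF integral_abs_bound] integral_mono integrable_abs
        Bochner_Integration.integrable_diff integrable_mult_right integrable_indicator_Ebounded
        assms(2) Ebounded_dyadic_box)
  also have "\<dots> = \<eta> * measure m (dyadic_box s)"
    using assms(2) by (simp add: space_LFmeasures)
  finally show ?thesis .
qed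

lemma integral_Cc_plus_in_mass_interior:
  assumes f: "f \<in> Cc_plus" and m: "m \<in> LFmeasures" and t: "t > 0"
  shows "\<exists>r. cell_masses r m \<in> mass_interior r {m'. \<bar>integral\<^sup>L m' f - integral\<^sup>L m f\<bar> < t}"
proof -
  obtain r where support: "\<And>z. z \<notin> dyadic_box r \<Longrightarrow> f z = 0"
    using Cc_plus_boundedE[OF f] by (metis abs_le_zero_iff indicator_simps(2) mult_zero_right)
  define C where "C = measure m (dyadic_box r) + 1"
  have C: "C > 0"
    unfolding C_def by (intro add_nonneg_pos) auto
  obtain s where s: "\<And>z. \<bar>f z - dyadic_step (r + s) f z\<bar> \<le> t / (4 * C) * indicator (dyadic_box r) z"
    using dyadic_step_approx[of f r "t / (4 * C)"] f support t C
    by (meson divide_pos_pos mult_pos_pos zero_less_numeral)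
  let ?I = "step_integral (r + s) f" and ?mass = "\<lambda>\<phi>. \<Sum>k\<in>window r. coarsen r s \<phi> k"
  let ?U = "{\<phi>. \<bar>?I \<phi> - ?I (cell_masses (r + s) m)\<bar> < t / 2} \<inter> {\<phi>. ?mass \<phi> < C}"
  have mass: "?mass (cell_masses (r + s) m') = measure m' (dyadic_box r)" if "m' \<in> LFmeasures" for m'
    by (simp add: that coarsen_cell_masses measure_dyadic_box)
  have error: "\<bar>integral\<^sup>L m' f - ?I (cell_masses (r + s) m')\<bar> < t / 4"
    if "m' \<in> LFmeasures" "cell_masses (r + s) m' \<in> ?U" for m'
  proof -
    have "\<bar>integral\<^sup>L m' f - ?I (cell_masses (r + s) m')\<bar> \<le> t / (4 * C) * measure m' (dyadic_box r)"
      by (rule integral_dyadic_step_approx[OF f that(1) s])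
    also have "\<dots> < t / (4 * C) * C"
      using that mass t C by (intro mult_strict_left_mono) auto
    finally show ?thesis
      using C by simp
  qed
  have "open ?U"
    by (intro open_Int open_Collect_less continuous_intros continuous_on_step_integral
        continuous_on_product_then_coordinatewise[OF continuous_on_coarsen])
  moreover have m_in: "cell_masses (r + s) m \<in> ?U"
    using t by (simp add: mass[OF m] C_def)
  moreover have "\<bar>integral\<^sup>L m' f - integral\<^sup>L m f\<bar> < t"
    if "m' \<in> LFmeasures" "cell_masses (r + s) m' \<in> ?U" for m'
  proof -
    have "\<bar>?I (cell_masses (r + s) m') - ?I (cell_masses (r + s) m)\<bar> < t / 2"
      using that(2) by simp
    then show ?thesis
      using error[OF that] error[OF m m_in] by linarith
  qed
  ultimately show ?thesis
    by (intro exI[of _ "r + s"] mass_interiorI[of ?U]) auto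
qed

lemma nn_integral_Cc_plus:
  assumes "f \<in> Cc_plus" "m \<in> LFmeasures"
  shows "(\<integral>\<^sup>+z. ennreal (f z) \<partial>m) = ennreal (integral\<^sup>L m f)"
  using assms by (intro nn_integral_eq_integral Cc_plus_integrable) (auto simp: Cc_plus_def)

lemma subbasic_in_mass_interior:
  assumes f: "f \<in> Cc_plus" and U: "open U" and m: "m \<in> LFmeasures"
    and "(\<integral>\<^sup>+z. ennreal (f z) \<partial>m) \<in> U"
  shows "\<exists>r. cell_masses r m \<in> mass_interior r {m. (\<integral>\<^sup>+z. ennreal (f z) \<partial>m) \<in> U}"
proof -
  have "open (ennreal -` U)"
    by (intro open_vimage[OF U] continuous_on_ennreal continuous_on_id)
  moreover have "integral\<^sup>L m f \<in> ennreal -` U"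
    using assms by (simp add: nn_integral_Cc_plus)
  ultimately obtain t where t: "t > 0" "\<And>x. \<bar>x - integral\<^sup>L m f\<bar> < t \<Longrightarrow> ennreal x \<in> U"
    unfolding open_dist dist_real_def by blast
  obtain r where "cell_masses r m \<in> mass_interior r {m'. \<bar>integral\<^sup>L m' f - integral\<^sup>L m f\<bar> < t}"
    using integral_Cc_plus_in_mass_interior[OF f m t(1)] by blast
  moreover have "{m'. \<bar>integral\<^sup>L m' f - integral\<^sup>L m f\<bar> < t} \<inter> LFmeasures
    \<subseteq> {m. (\<integral>\<^sup>+z. ennreal (f z) \<partial>m) \<in> U}"
    using t(2) by (auto simp: nn_integral_Cc_plus f)
  ultimately show ?thesis
    using mass_interior_mono by blast
qed

lemma vague_open_iff_mass_interior:
  assumes G: "openin vague_topology G" and m: "m \<in> LFmeasures"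
  shows "m \<in> G \<longleftrightarrow> (\<exists>r. cell_masses r m \<in> mass_interior r G)"
proof
  let ?S = "{{m. (\<integral>\<^sup>+ z. ennreal (f z) \<partial>m) \<in> U} | f U. f \<in> Cc_plus \<and> open U}"
  obtain T where T: "generate_topology_on ?S T" "G = T \<inter> LFmeasures"
    using G unfolding vague_topology_def openin_subtopology openin_topology_generated_by_iff by blast
  from T(1) have "m \<in> T \<Longrightarrow> \<exists>r. cell_masses r m \<in> mass_interior r T"
  proof (induction T rule: generate_topology_on.induct)
    case (Int A B)
    then obtain r s where "cell_masses r m \<in> mass_interior r A" "cell_masses s m \<in> mass_interior s B"
      by blast
    then have "cell_masses (r + s) m \<in> mass_interior (r + s) A \<inter> mass_interior (r + s) B"
      using mass_interior_add[OF m, of r A s] mass_interior_add[OF m, of s B r]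
      by (simp add: add.commute)
    then show ?case
      using mass_interior_Int by blast
  next
    case (UN \<K>)
    then show ?case
      by (metis UnionE Union_upper inf.coboundedI1 mass_interior_mono subsetD)
  next
    case (Basis A)
    then show ?case
      using subbasic_in_mass_interior[OF _ _ m] by blast
  qed simp
  moreover have "mass_interior r T \<subseteq> mass_interior r G" for r
    unfolding T(2) by (rule mass_interior_mono) simp
  ultimately show "\<exists>r. cell_masses r m \<in> mass_interior r G" if "m \<in> G"
    using that T(2) by blast
qed (use mass_interior_imp[OF m] in blast)

lemma topspace_vague_topology: "topspace vague_topology = LFmeasures"
proof -
  have "(\<lambda>z. 0) \<in> Cc_plus"
    unfolding Cc_plus_def by (auto intro!: exI[of _ "{}"])
  then have "\<Union>{{m. (\<integral>\<^sup>+ z. ennreal (f z) \<partial>m) \<in> U} | f U. f \<in> Cc_plus \<and> open U} = UNIV"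
    by (auto intro!: exI[of _ "UNIV :: (real \<times> real) measure set"] exI[of _ "\<lambda>z. 0"] exI[of _ UNIV])
  then show ?thesis
    unfolding vague_topology_def topspace_subtopology topology_generated_by_topspace by simp
qed

section \<open>Convergence in distribution from open sets\<close>

lemma weak_conv_m_if_liminf_open:
  assumes "\<And>n. real_distribution (\<mu> n)" "real_distribution \<nu>"
    and liminf: "\<And>U e. open U \<Longrightarrow> e > 0 \<Longrightarrow>
      \<forall>\<^sub>F n in sequentially. measure \<nu> U - e < measure (\<mu> n) U"
  shows "weak_conv_m \<mu> \<nu>"
  unfolding weak_conv_m_def weak_conv_def
proof (intro allI impI)
  interpret \<mu>: real_distribution "\<mu> n" for n by fact
  interpret \<nu>: real_distribution \<nu> by fact
  fix x assume "isCont (cdf \<nu>) x"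
  then have "measure \<nu> {x} = 0"
    by (simp add: \<nu>.isCont_cdf)
  moreover have "measure \<nu> ({..<x} \<union> {x}) = measure \<nu> {..<x} + measure \<nu> {x}"
    by (intro \<nu>.finite_measure_Union) auto
  moreover have "{..<x} \<union> {x} = {..x}"
    by auto
  ultimately have cdf_\<nu>: "cdf \<nu> x = measure \<nu> {..<x}"
    by (simp add: cdf_def2)
  have below: "measure (\<mu> n) {..<x} \<le> cdf (\<mu> n) x" for n
    unfolding cdf_def2 by (intro \<mu>.finite_measure_mono) auto
  have above: "measure \<nu> {x<..} = 1 - cdf \<nu> x" "\<And>n. measure (\<mu> n) {x<..} = 1 - cdf (\<mu> n) x"
    using \<mu>.prob_compl[of "{..x}"] \<nu>.prob_compl[of "{..x}"] Compl_atMost[of x]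
    by (simp_all add: cdf_def2 Compl_eq_Diff_UNIV)
  show "(\<lambda>n. cdf (\<mu> n) x) \<longlonglongrightarrow> cdf \<nu> x"
  proof (rule tendstoI)
    fix e :: real assume "e > 0"
    then have "\<forall>\<^sub>F n in sequentially. measure \<nu> {x<..} - e < measure (\<mu> n) {x<..}"
      "\<forall>\<^sub>F n in sequentially. measure \<nu> {..<x} - e < measure (\<mu> n) {..<x}"
      by (auto intro: liminf)
    then show "\<forall>\<^sub>F n in sequentially. dist (cdf (\<mu> n) x) (cdf \<nu> x) < e"
    proof eventually_elim
      case (elim n)
      then show ?case
        using above below[of n] cdf_\<nu> by (simp add: dist_real_def abs_less_iff)
    qed
  qed
qed

lemma tendsto_integral_bounded_if_liminf_open:
  fixes X :: "nat \<Rightarrow> 'a \<Rightarrow> real" and Y :: "'b \<Rightarrow> real"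
  assumes M: "prob_space M" and N: "prob_space N"
    and X [measurable]: "\<And>n. X n \<in> borel_measurable M" and Y [measurable]: "Y \<in> borel_measurable N"
    and X_bound: "\<And>n \<omega>. \<omega> \<in> space M \<Longrightarrow> \<bar>X n \<omega>\<bar> \<le> B" and Y_bound: "\<And>\<omega>. \<omega> \<in> space N \<Longrightarrow> \<bar>Y \<omega>\<bar> \<le> B"
    and liminf: "\<And>U e. open U \<Longrightarrow> e > 0 \<Longrightarrow> \<forall>\<^sub>F n in sequentially.
      measure N {\<omega> \<in> space N. Y \<omega> \<in> U} - e < measure M {\<omega> \<in> space M. X n \<omega> \<in> U}"
  shows "(\<lambda>n. integral\<^sup>L M (X n)) \<longlonglongrightarrow> integral\<^sup>L N Y"
proof -
  define clamp where "clamp t = max (- B) (min B t)" for t :: real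
  have [measurable]: "clamp \<in> borel_measurable borel"
    unfolding clamp_def by measurable
  have clamp_id: "clamp t = t" if "\<bar>t\<bar> \<le> B" for t
    unfolding clamp_def using that by auto
  have distr_X: "real_distribution (distr M borel (X n))" for n
    by (rule prob_space.real_distribution_distr[OF M X])
  have distr_Y: "real_distribution (distr N borel Y)"
    by (rule prob_space.real_distribution_distr[OF N Y])
  have weak: "weak_conv_m (\<lambda>n. distr M borel (X n)) (distr N borel Y)"
    by (intro weak_conv_m_if_liminf_open distr_X distr_Y)
      (simp add: measure_distr vimage_def Int_def conj_commute liminf)
  have "(\<lambda>n. integral\<^sup>L (distr M borel (X n)) clamp) \<longlonglongrightarrow> integral\<^sup>L (distr N borel Y) clamp"
  proof (rule weak_conv_imp_integral_bdd_continuous_conv[OF distr_X distr_Y weak])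
    show "isCont clamp t" for t
      unfolding clamp_def[abs_def] by (intro continuous_intros)
    show "norm (clamp t) \<le> \<bar>B\<bar>" for t
      by (auto simp: clamp_def)
  qed
  moreover have "integral\<^sup>L (distr M borel (X n)) clamp = integral\<^sup>L M (X n)" for n
    by (simp add: integral_distr X_bound clamp_id cong: Bochner_Integration.integral_cong)
  moreover have "integral\<^sup>L (distr N borel Y) clamp = integral\<^sup>L N Y"
    by (simp add: integral_distr Y_bound clamp_id cong: Bochner_Integration.integral_cong)
  ultimately show ?thesis
    by simp
qed

lemma openin_vague_preimage:
  assumes "continuous_map vague_topology euclidean g" "open U"
  shows "openin vague_topology {m \<in> LFmeasures. g m \<in> U}"
  using openin_continuous_map_preimage[OF assms(1), of U] assms(2)
  by (simp add: topspace_vague_topology)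

locale random_LFmeasure = prob_space M for M :: "'a measure" +
  fixes X :: "'a \<Rightarrow> (real \<times> real) measure"
  assumes X_LF: "\<omega> \<in> space M \<Longrightarrow> X \<omega> \<in> LFmeasures"
    and emeasure_X_measurable: "a > 0 \<Longrightarrow> b > 0 \<Longrightarrow> snd k \<ge> 1 \<Longrightarrow>
      (\<lambda>\<omega>. emeasure (X \<omega>) (grid_cell a b k)) \<in> borel_measurable M"
begin

lemma mass_interior_event:
  "{\<omega> \<in> space M. cell_masses r (X \<omega>) \<in> mass_interior r G} \<in> events"
proof -
  have "(\<lambda>\<omega>. cell_masses r (X \<omega>) k) \<in> borel_measurable M" for k
    using emeasure_X_measurable[of "2 ^ r" "2 ^ r" k] window_snd_ge_1[of k r]
    unfolding cell_masses_def measure_def by (cases "k \<in> window r") auto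
  then have "(\<lambda>\<omega>. cell_masses r (X \<omega>)) \<in> borel_measurable M"
    by (rule measurable_coordinatewise_then_product)
  from measurable_sets[OF this borel_open[OF open_mass_interior]] show ?thesis
    by (simp add: vimage_def Int_def conj_commute)
qed

lemma vague_open_eq_UN_mass_interior:
  assumes "openin vague_topology G"
  shows "{\<omega> \<in> space M. X \<omega> \<in> G} = (\<Union>r. {\<omega> \<in> space M. cell_masses r (X \<omega>) \<in> mass_interior r G})"
  using vague_open_iff_mass_interior[OF assms] X_LF by auto

lemma vague_open_event:
  assumes "openin vague_topology G"
  shows "{\<omega> \<in> space M. X \<omega> \<in> G} \<in> events"
  unfolding vague_open_eq_UN_mass_interior[OF assms] using mass_interior_event by auto

lemma prob_mass_interior_tendsto:
  assumes "openin vague_topology G"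
  shows "(\<lambda>r. prob {\<omega> \<in> space M. cell_masses r (X \<omega>) \<in> mass_interior r G})
    \<longlonglongrightarrow> prob {\<omega> \<in> space M. X \<omega> \<in> G}"
  unfolding vague_open_eq_UN_mass_interior[OF assms]
  using mass_interior_event mass_interior_add[OF X_LF, where s = 1]
  by (intro finite_Lim_measure_incseq incseq_SucI) auto

lemma vague_continuous_measurable:
  fixes g :: "(real \<times> real) measure \<Rightarrow> real"
  assumes "continuous_map vague_topology euclidean g"
  shows "(\<lambda>\<omega>. g (X \<omega>)) \<in> borel_measurable M"
proof (rule borel_measurableI)
  fix U :: "real set" assume "open U"
  from vague_open_event[OF openin_vague_preimage[OF assms this]]
  show "(\<lambda>\<omega>. g (X \<omega>)) -` U \<inter> space M \<in> events"
    using X_LF by (simp add: vimage_def Int_def conj_commute cong: conj_cong)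
qed

end

lemma conv_distr_vague_if_liminf_open:
  assumes X: "\<And>n. random_LFmeasure M (X n)" and Y: "random_LFmeasure N Y"
    and liminf: "\<And>G e. openin vague_topology G \<Longrightarrow> e > 0 \<Longrightarrow> \<forall>\<^sub>F n in sequentially.
      measure N {\<omega> \<in> space N. Y \<omega> \<in> G} - e < measure M {\<omega> \<in> space M. X n \<omega> \<in> G}"
  shows "conv_distr_vague M X N Y"
  unfolding conv_distr_vague_def
proof (intro allI impI, elim conjE)
  fix g :: "(real \<times> real) measure \<Rightarrow> real"
  assume g: "continuous_map vague_topology euclidean g" and "bounded (g ` LFmeasures)"
  then obtain B where B: "\<And>m. m \<in> LFmeasures \<Longrightarrow> \<bar>g m\<bar> \<le> B"
    unfolding bounded_iff by auto
  interpret X: random_LFmeasure M "X n" for n by fact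
  interpret Y: random_LFmeasure N Y by fact
  show "(\<lambda>n. integral\<^sup>L M (\<lambda>\<omega>. g (X n \<omega>))) \<longlonglongrightarrow> integral\<^sup>L N (\<lambda>\<omega>. g (Y \<omega>))"
  proof (rule tendsto_integral_bounded_if_liminf_open)
    fix U :: "real set" and e :: real assume "open U" "e > 0"
    from liminf[OF openin_vague_preimage[OF g this(1)] this(2)] show "\<forall>\<^sub>F n in sequentially.
      measure N {\<omega> \<in> space N. g (Y \<omega>) \<in> U} - e < measure M {\<omega> \<in> space M. g (X n \<omega>) \<in> U}"
      using X.X_LF Y.X_LF by (simp cong: conj_cong)
  qed (use B X.X_LF Y.X_LF X.vague_continuous_measurable[OF g] Y.vague_continuous_measurable[OF g]
      X.prob_space_axioms Y.prob_space_axioms in auto)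
qed

lemma conv_distr_vague_if_Suc:
  assumes "conv_distr_vague M (\<lambda>n. X (Suc n)) N Y"
  shows "conv_distr_vague M X N Y"
  unfolding conv_distr_vague_def
proof (intro allI impI)
  fix g :: "(real \<times> real) measure \<Rightarrow> real"
  assume "continuous_map vague_topology euclidean g \<and> bounded (g ` LFmeasures)"
  then have "(\<lambda>n. integral\<^sup>L M (\<lambda>\<omega>. g (X (Suc n) \<omega>))) \<longlonglongrightarrow> integral\<^sup>L N (\<lambda>\<omega>. g (Y \<omega>))"
    using assms unfolding conv_distr_vague_def by blast
  then show "(\<lambda>n. integral\<^sup>L M (\<lambda>\<omega>. g (X n \<omega>))) \<longlonglongrightarrow> integral\<^sup>L N (\<lambda>\<omega>. g (Y \<omega>))"
    by (rule LIMSEQ_imp_Suc)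
qed

section \<open>Occupied strips\<close>

definition pattern_event :: "'a measure \<Rightarrow> ('i \<Rightarrow> 'a set) \<Rightarrow> 'i set \<Rightarrow> 'i set \<Rightarrow> 'a set" where
  "pattern_event M E A D = {\<omega> \<in> space M. (\<forall>i\<in>A. \<omega> \<notin> E i) \<and> (\<forall>i\<in>D. \<omega> \<in> E i)}"

lemma pattern_event_sets:
  assumes "finite J" "\<And>i. i \<in> J \<Longrightarrow> E i \<in> sets M" "A \<subseteq> J" "D \<subseteq> J"
  shows "pattern_event M E A D \<in> sets M"
proof -
  have "finite A" "finite D"
    using assms finite_subset by blast+
  moreover have "{\<omega> \<in> space M. \<omega> \<in> E i} \<in> sets M" if "i \<in> J" for i
    using assms(2)[OF that] sets.Int_space_eq1 by (simp add: Int_def[symmetric])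
  ultimately show ?thesis
    unfolding pattern_event_def using assms(3,4)
    by (intro sets.sets_Collect_conj sets.sets_Collect_finite_All sets.sets_Collect_neg) auto
qed

lemma (in finite_measure) measure_pattern_event_insert:
  assumes "finite J" "\<And>i. i \<in> J \<Longrightarrow> E i \<in> sets M" "A \<subseteq> J" "insert d D \<subseteq> J"
  shows "measure M (pattern_event M E A (insert d D)) =
    measure M (pattern_event M E A D) - measure M (pattern_event M E (insert d A) D)"
proof -
  have "pattern_event M E A (insert d D) = pattern_event M E A D - pattern_event M E (insert d A) D"
    by (auto simp: pattern_event_def)
  moreover have "pattern_event M E (insert d A) D \<subseteq> pattern_event M E A D"
    by (auto simp: pattern_event_def)
  ultimately show ?thesis
    using assms by (simp add: finite_measure_Diff pattern_event_sets[of J])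
qed

lemma tendsto_measure_pattern_event:
  fixes E :: "nat \<Rightarrow> 'i \<Rightarrow> 'a set" and E' :: "'i \<Rightarrow> 'b set"
  assumes M: "finite_measure M" and N: "finite_measure N" and J: "finite J"
    and E: "\<And>n i. i \<in> J \<Longrightarrow> E n i \<in> sets M" and E': "\<And>i. i \<in> J \<Longrightarrow> E' i \<in> sets N"
    and void: "\<And>A. A \<subseteq> J \<Longrightarrow>
      (\<lambda>n. measure M (pattern_event M (E n) A {})) \<longlonglongrightarrow> measure N (pattern_event N E' A {})"
    and "finite D" "D \<subseteq> J" "A \<subseteq> J"
  shows "(\<lambda>n. measure M (pattern_event M (E n) A D)) \<longlonglongrightarrow> measure N (pattern_event N E' A D)"
  using \<open>finite D\<close> \<open>D \<subseteq> J\<close> \<open>A \<subseteq> J\<close>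
proof (induction D arbitrary: A rule: finite_induct)
  case empty
  then show ?case
    using void by simp
next
  case (insert d D)
  then show ?case
    using finite_measure.measure_pattern_event_insert[OF M J E insert.prems(2,1)]
      finite_measure.measure_pattern_event_insert[OF N J E' insert.prems(2,1)]
    by (auto intro!: tendsto_diff insert.IH)
qed

lemma occupied_event_eq_UN:
  "{\<omega> \<in> space M. {i \<in> J. \<omega> \<in> E i} \<in> \<D>} = (\<Union>D\<in>\<D> \<inter> Pow J. pattern_event M E (J - D) D)"
proof (intro set_eqI iffI)
  fix \<omega> assume "\<omega> \<in> {\<omega> \<in> space M. {i \<in> J. \<omega> \<in> E i} \<in> \<D>}"
  then show "\<omega> \<in> (\<Union>D\<in>\<D> \<inter> Pow J. pattern_event M E (J - D) D)"
    unfolding pattern_event_def by (intro UN_I[of "{i \<in> J. \<omega> \<in> E i}"]) auto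
next
  fix \<omega> assume "\<omega> \<in> (\<Union>D\<in>\<D> \<inter> Pow J. pattern_event M E (J - D) D)"
  then obtain D where "D \<in> \<D>" "D \<subseteq> J" "\<omega> \<in> pattern_event M E (J - D) D"
    by auto
  moreover from this have "{i \<in> J. \<omega> \<in> E i} = D"
    by (auto simp: pattern_event_def)
  ultimately show "\<omega> \<in> {\<omega> \<in> space M. {i \<in> J. \<omega> \<in> E i} \<in> \<D>}"
    by (simp add: pattern_event_def)
qed

lemma (in finite_measure) measure_occupied_event:
  assumes "finite J" "\<And>i. i \<in> J \<Longrightarrow> E i \<in> sets M"
  shows "measure M {\<omega> \<in> space M. {i \<in> J. \<omega> \<in> E i} \<in> \<D>} =
    (\<Sum>D\<in>\<D> \<inter> Pow J. measure M (pattern_event M E (J - D) D))"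
  unfolding occupied_event_eq_UN
proof (rule finite_measure_finite_Union)
  show "disjoint_family_on (\<lambda>D. pattern_event M E (J - D) D) (\<D> \<inter> Pow J)"
    unfolding disjoint_family_on_def pattern_event_def by blast
qed (use assms pattern_event_sets[of J E] in auto)

lemma tendsto_measure_occupied_event:
  fixes E :: "nat \<Rightarrow> 'i \<Rightarrow> 'a set" and E' :: "'i \<Rightarrow> 'b set"
  assumes M: "finite_measure M" and N: "finite_measure N" and J: "finite J"
    and E: "\<And>n i. i \<in> J \<Longrightarrow> E n i \<in> sets M" and E': "\<And>i. i \<in> J \<Longrightarrow> E' i \<in> sets N"
    and void: "\<And>A. A \<subseteq> J \<Longrightarrow>
      (\<lambda>n. measure M (pattern_event M (E n) A {})) \<longlonglongrightarrow> measure N (pattern_event N E' A {})"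
  shows "(\<lambda>n. measure M {\<omega> \<in> space M. {i \<in> J. \<omega> \<in> E n i} \<in> \<D>})
    \<longlonglongrightarrow> measure N {\<omega> \<in> space N. {i \<in> J. \<omega> \<in> E' i} \<in> \<D>}"
proof -
  have "(\<lambda>n. measure M (pattern_event M (E n) (J - D) D)) \<longlonglongrightarrow> measure N (pattern_event N E' (J - D) D)"
    if "D \<subseteq> J" for D
    using that finite_subset[OF that J]
    by (intro tendsto_measure_pattern_event[OF M N J E E' void]) auto
  then show ?thesis
    using finite_measure.measure_occupied_event[OF M J E]
      finite_measure.measure_occupied_event[OF N J E']
    by (auto intro!: tendsto_sum)
qed

definition strips :: "nat \<Rightarrow> nat \<Rightarrow> (int \<times> int) set" where
  "strips r K = (\<Union>k\<in>window r. refine_idx K 1 k)"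

abbreviation strip_cell :: "nat \<Rightarrow> nat \<Rightarrow> int \<times> int \<Rightarrow> (real \<times> real) set" where
  "strip_cell r K \<equiv> grid_cell (2 ^ r * K) (2 ^ r)"

definition occupied_strips :: "nat \<Rightarrow> nat \<Rightarrow> (real \<times> real) measure \<Rightarrow> (int \<times> int) set" where
  "occupied_strips r K m = {k \<in> strips r K. emeasure m (strip_cell r K k) \<noteq> 0}"

definition simple_on_strips :: "nat \<Rightarrow> nat \<Rightarrow> (real \<times> real) measure \<Rightarrow> bool" where
  "simple_on_strips r K m \<longleftrightarrow> (\<forall>k\<in>strips r K. emeasure m (strip_cell r K k) \<in> {0, 1})"

definition strip_counts :: "nat \<Rightarrow> nat \<Rightarrow> (int \<times> int) set \<Rightarrow> int \<times> int \<Rightarrow> real" where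
  "strip_counts r K D k = (if k \<in> window r then real (card (refine_idx K 1 k \<inter> D)) else 0)"

definition forcing_patterns :: "nat \<Rightarrow> nat \<Rightarrow> (real \<times> real) measure set \<Rightarrow> (int \<times> int) set set" where
  "forcing_patterns r K G = {D. strip_counts r K D \<in> mass_interior r G}"

lemma finite_strips [simp]: "finite (strips r K)"
  by (simp add: strips_def)

lemma strips_snd_ge_1: "k \<in> strips r K \<Longrightarrow> snd k \<ge> 1"
  unfolding strips_def by (auto intro: snd_refine_idx_ge_1[OF _ window_snd_ge_1])

lemma cell_masses_if_simple_on_strips:
  assumes m: "m \<in> LFmeasures" and K: "K > 0" and simple: "simple_on_strips r K m"
  shows "cell_masses r m = strip_counts r K (occupied_strips r K m)"
proof
  fix k
  have "measure m (dyadic_cell r k) = real (card (refine_idx K 1 k \<inter> occupied_strips r K m))"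
    if k: "k \<in> window r"
  proof -
    have "measure m (dyadic_cell r k) = (\<Sum>k'\<in>refine_idx K 1 k. measure m (strip_cell r K k'))"
      using measure_grid_cell_refine[OF m K, of 1 "2 ^ r" "2 ^ r" k] window_snd_ge_1[OF k] by simp
    also have "\<dots> = (\<Sum>k'\<in>refine_idx K 1 k. if k' \<in> occupied_strips r K m then 1 else 0)"
      using simple k unfolding simple_on_strips_def occupied_strips_def strips_def
      by (intro sum.cong) (auto simp: measure_def)
    finally show ?thesis
      by (simp add: sum.If_cases)
  qed
  then show "cell_masses r m k = strip_counts r K (occupied_strips r K m) k"
    by (simp add: cell_masses_def strip_counts_def)
qed

context random_LFmeasure
begin

lemma emeasure_X_event:
  assumes "a > 0" "b > 0" "snd k \<ge> 1" "B \<in> sets borel"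
  shows "{\<omega> \<in> space M. emeasure (X \<omega>) (grid_cell a b k) \<in> B} \<in> events"
  using measurable_sets[OF emeasure_X_measurable[OF assms(1-3)] assms(4)]
  by (simp add: vimage_def Int_def conj_commute)

lemma strip_event:
  assumes "K > 0" "k \<in> strips r K" "B \<in> sets borel"
  shows "{\<omega> \<in> space M. emeasure (X \<omega>) (strip_cell r K k) \<in> B} \<in> events"
  using assms strips_snd_ge_1 by (intro emeasure_X_event) auto

lemma simple_on_strips_event:
  assumes "K > 0"
  shows "{\<omega> \<in> space M. \<not> simple_on_strips r K (X \<omega>)} \<in> events"
  unfolding simple_on_strips_def using assms
  by (intro sets.sets_Collect_neg sets.sets_Collect_finite_All strip_event) auto

lemma occupied_strips_event:
  assumes "K > 0"
  shows "{\<omega> \<in> space M. occupied_strips r K (X \<omega>) \<in> \<D>} \<in> events"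
proof -
  let ?E = "\<lambda>k. {\<omega> \<in> space M. emeasure (X \<omega>) (strip_cell r K k) \<in> - {0}}"
  have "{\<omega> \<in> space M. occupied_strips r K (X \<omega>) \<in> \<D>} = {\<omega> \<in> space M. {k \<in> strips r K. \<omega> \<in> ?E k} \<in> \<D>}"
    by (simp add: occupied_strips_def cong: conj_cong)
  also have "\<dots> \<in> events"
    unfolding occupied_event_eq_UN using assms
    by (intro sets.finite_UN pattern_event_sets[of "strips r K"] strip_event) auto
  finally show ?thesis .
qed

lemma prob_le_add_prob_not_simple:
  assumes "A \<in> events" "B \<in> events" "K > 0"
    and "\<And>\<omega>. \<omega> \<in> A \<Longrightarrow> simple_on_strips r K (X \<omega>) \<Longrightarrow> \<omega> \<in> B"
  shows "prob A \<le> prob B + prob {\<omega> \<in> space M. \<not> simple_on_strips r K (X \<omega>)}"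
proof -
  have "prob A \<le> prob (B \<union> {\<omega> \<in> space M. \<not> simple_on_strips r K (X \<omega>)})"
    using assms simple_on_strips_event sets.sets_into_space[OF assms(1)]
    by (intro finite_measure_mono) auto
  also have "\<dots> \<le> prob B + prob {\<omega> \<in> space M. \<not> simple_on_strips r K (X \<omega>)}"
    using assms simple_on_strips_event by (intro measure_Un_le)
  finally show ?thesis .
qed

lemma prob_mass_interior_le_prob_occupied:
  assumes "K > 0"
  shows "prob {\<omega> \<in> space M. cell_masses r (X \<omega>) \<in> mass_interior r G}
    \<le> prob {\<omega> \<in> space M. occupied_strips r K (X \<omega>) \<in> forcing_patterns r K G}
      + prob {\<omega> \<in> space M. \<not> simple_on_strips r K (X \<omega>)}"
  using X_LF assms
  by (intro prob_le_add_prob_not_simple mass_interior_event occupied_strips_event)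
    (auto simp: forcing_patterns_def cell_masses_if_simple_on_strips)

lemma prob_occupied_le_prob_vague_open:
  assumes K: "K > 0" and G: "openin vague_topology G"
  shows "prob {\<omega> \<in> space M. occupied_strips r K (X \<omega>) \<in> forcing_patterns r K G}
    \<le> prob {\<omega> \<in> space M. X \<omega> \<in> G} + prob {\<omega> \<in> space M. \<not> simple_on_strips r K (X \<omega>)}"
proof (intro prob_le_add_prob_not_simple occupied_strips_event K vague_open_event G)
  fix \<omega> assume "\<omega> \<in> {\<omega> \<in> space M. occupied_strips r K (X \<omega>) \<in> forcing_patterns r K G}"
    and "simple_on_strips r K (X \<omega>)"
  then have "\<omega> \<in> space M" "cell_masses r (X \<omega>) \<in> mass_interior r G"
    using X_LF K by (auto simp: forcing_patterns_def cell_masses_if_simple_on_strips)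
  then show "\<omega> \<in> {\<omega> \<in> space M. X \<omega> \<in> G}"
    using mass_interior_imp[OF X_LF] by blast
qed

lemma prob_not_simple_le:
  assumes K: "K > 0"
    and multiple: "\<And>k k'. k \<in> window r \<Longrightarrow> k' \<in> refine_idx K 1 k \<Longrightarrow>
      prob {\<omega> \<in> space M. emeasure (X \<omega>) (strip_cell r K k') \<notin> {0, 1}} \<le> \<beta> k / (real K)\<^sup>2"
  shows "prob {\<omega> \<in> space M. \<not> simple_on_strips r K (X \<omega>)} \<le> (\<Sum>k\<in>window r. \<beta> k) / real K"
proof -
  let ?E = "\<lambda>k'. {\<omega> \<in> space M. emeasure (X \<omega>) (strip_cell r K k') \<notin> {0, 1}}"
  have E: "?E k' \<in> events" if "k \<in> window r" "k' \<in> refine_idx K 1 k" for k k'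
    using strip_event[OF K, of k' r "- {0, 1}"] that by (auto simp: strips_def)
  have "prob {\<omega> \<in> space M. \<not> simple_on_strips r K (X \<omega>)}
      = prob (\<Union>k\<in>window r. \<Union>k'\<in>refine_idx K 1 k. ?E k')"
    by (auto simp: simple_on_strips_def strips_def intro!: arg_cong[where f = prob])
  also have "\<dots> \<le> (\<Sum>k\<in>window r. \<Sum>k'\<in>refine_idx K 1 k. prob (?E k'))"
    using E by (intro order_trans[OF finite_measure_subadditive_finite] sum_mono
        finite_measure_subadditive_finite) auto
  also have "\<dots> \<le> (\<Sum>k\<in>window r. \<Sum>k'\<in>refine_idx K 1 k. \<beta> k / (real K)\<^sup>2)"
    by (intro sum_mono multiple)
  also have "\<dots> = (\<Sum>k\<in>window r. \<beta> k) / real K"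
    using K by (simp add: card_refine_idx power2_eq_square sum_divide_distrib)
  finally show ?thesis .
qed

end

lemma vague_liminf_open:
  assumes X: "\<And>n. random_LFmeasure M (X n)" and Y: "random_LFmeasure N Y"
    and occupied: "\<And>r K \<D>. K > 0 \<Longrightarrow>
      (\<lambda>n. measure M {\<omega> \<in> space M. occupied_strips r K (X n \<omega>) \<in> \<D>})
      \<longlonglongrightarrow> measure N {\<omega> \<in> space N. occupied_strips r K (Y \<omega>) \<in> \<D>}"
    and simple: "\<And>r e. e > 0 \<Longrightarrow> \<exists>K>0. measure N {\<omega> \<in> space N. \<not> simple_on_strips r K (Y \<omega>)} < e \<and>
      (\<forall>\<^sub>F n in sequentially. measure M {\<omega> \<in> space M. \<not> simple_on_strips r K (X n \<omega>)} < e)"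
    and G: "openin vague_topology G" and e: "e > 0"
  shows "\<forall>\<^sub>F n in sequentially.
    measure N {\<omega> \<in> space N. Y \<omega> \<in> G} - e < measure M {\<omega> \<in> space M. X n \<omega> \<in> G}"
proof -
  interpret X: random_LFmeasure M "X n" for n by fact
  interpret Y: random_LFmeasure N Y by fact
  have "\<forall>\<^sub>F r in sequentially. measure N {\<omega> \<in> space N. Y \<omega> \<in> G} - e / 4
    < measure N {\<omega> \<in> space N. cell_masses r (Y \<omega>) \<in> mass_interior r G}"
    using e by (intro order_tendstoD(1)[OF Y.prob_mass_interior_tendsto[OF G]]) simp
  then obtain r where r: "measure N {\<omega> \<in> space N. Y \<omega> \<in> G} - e / 4
    < measure N {\<omega> \<in> space N. cell_masses r (Y \<omega>) \<in> mass_interior r G}"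
    by (auto simp: eventually_sequentially)
  obtain K where K: "K > 0"
    and Y_simple: "measure N {\<omega> \<in> space N. \<not> simple_on_strips r K (Y \<omega>)} < e / 4"
    and X_simple: "\<forall>\<^sub>F n in sequentially.
      measure M {\<omega> \<in> space M. \<not> simple_on_strips r K (X n \<omega>)} < e / 4"
    using simple[of "e / 4" r] e by auto
  let ?\<D> = "forcing_patterns r K G"
  have "\<forall>\<^sub>F n in sequentially. measure N {\<omega> \<in> space N. occupied_strips r K (Y \<omega>) \<in> ?\<D>} - e / 4
    < measure M {\<omega> \<in> space M. occupied_strips r K (X n \<omega>) \<in> ?\<D>}"
    using e by (intro order_tendstoD(1)[OF occupied[OF K]]) simp
  with X_simple show ?thesis
  proof eventually_elim
    case (elim n)
    then show ?case
      using r Y_simple Y.prob_mass_interior_le_prob_occupied[OF K, of r G]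
        X.prob_occupied_le_prob_vague_open[OF K G, of r n] by linarith
  qed
qed

section \<open>Convergence to a Poisson process\<close>

lemma one_minus_approx_exp:
  fixes p :: real
  assumes "0 \<le> p"
  shows "\<bar>(1 - p) - exp (- p)\<bar> \<le> p\<^sup>2"
proof -
  have "exp (- p) * (1 + p) \<le> exp (- p) * exp p"
    by (intro mult_left_mono) auto
  also have "\<dots> \<le> 1 + p ^ 3"
    using assms by (simp flip: exp_add)
  also have "\<dots> = (1 - p + p\<^sup>2) * (1 + p)"
    by (simp add: algebra_simps power2_eq_square power3_eq_cube)
  finally have "exp (- p) \<le> 1 - p + p\<^sup>2"
    using assms by simp
  then show ?thesis
    using exp_ge_add_one_self[of "- p"] by simp
qed

lemma (in prob_space) prob_multiple_add_prob_nonzero_le: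
  fixes Z :: "'a \<Rightarrow> ennreal"
  assumes [measurable]: "Z \<in> borel_measurable M" and Nats: "\<And>\<omega>. \<omega> \<in> space M \<Longrightarrow> Z \<omega> \<in> \<nat>"
  shows "ennreal (prob {\<omega> \<in> space M. Z \<omega> \<notin> {0, 1}} + (1 - prob {\<omega> \<in> space M. Z \<omega> = 0}))
    \<le> (\<integral>\<^sup>+\<omega>. Z \<omega> \<partial>M)"
proof -
  let ?multiple = "{\<omega> \<in> space M. Z \<omega> \<notin> {0, 1}}" and ?zero = "{\<omega> \<in> space M. Z \<omega> = 0}"
  have [measurable]: "?multiple \<in> events" "?zero \<in> events"
    by measurable
  have "indicator ?multiple \<omega> + indicator (space M - ?zero) \<omega> \<le> Z \<omega>" if \<omega>: "\<omega> \<in> space M" for \<omega>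
  proof -
    obtain i where "Z \<omega> = of_nat i"
      using Nats[OF \<omega>] by (auto elim: Nats_cases)
    moreover have "(of_nat 2 :: ennreal) \<le> of_nat i" if "i \<noteq> 0" "i \<noteq> 1"
      using that by (intro of_nat_mono) simp
    ultimately show ?thesis
      using \<omega> by (cases "i = 0"; cases "i = 1") (auto simp: indicator_def)
  qed
  then have "(\<integral>\<^sup>+\<omega>. indicator ?multiple \<omega> + indicator (space M - ?zero) \<omega> \<partial>M) \<le> (\<integral>\<^sup>+\<omega>. Z \<omega> \<partial>M)"
    by (intro nn_integral_mono)
  then have "emeasure M ?multiple + emeasure M (space M - ?zero) \<le> (\<integral>\<^sup>+\<omega>. Z \<omega> \<partial>M)"
    by (simp add: nn_integral_add)
  then show ?thesis
    by (simp add: emeasure_eq_measure prob_compl)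
qed

text \<open>Void probability and mean of a small cell are close to those of a Bernoulli variable, which
  leaves no room for multiple points.\<close>

lemma (in prob_space) eventually_prob_multiple_less:
  fixes Z :: "nat \<Rightarrow> 'a \<Rightarrow> ennreal"
  assumes Z: "\<And>n. Z n \<in> borel_measurable M" "\<And>n \<omega>. \<omega> \<in> space M \<Longrightarrow> Z n \<omega> \<in> \<nat>"
    and mean: "(\<lambda>n. \<integral>\<^sup>+\<omega>. Z n \<omega> \<partial>M) \<longlonglongrightarrow> ennreal w"
    and void: "(\<lambda>n. prob {\<omega> \<in> space M. Z n \<omega> = 0}) \<longlonglongrightarrow> exp (- w)"
    and w: "w \<ge> 0" and e: "e > 0"
  shows "\<forall>\<^sub>F n in sequentially. prob {\<omega> \<in> space M. Z n \<omega> \<notin> {0, 1}} < w\<^sup>2 + e"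
proof -
  have "\<forall>\<^sub>F n in sequentially. (\<integral>\<^sup>+\<omega>. Z n \<omega> \<partial>M) < ennreal (w + e / 2)"
    using w e by (intro order_tendstoD(2)[OF mean]) (simp add: ennreal_lessI)
  moreover have "\<forall>\<^sub>F n in sequentially. prob {\<omega> \<in> space M. Z n \<omega> = 0} < exp (- w) + e / 2"
    using e by (intro order_tendstoD(2)[OF void]) simp
  ultimately show ?thesis
  proof eventually_elim
    case (elim n)
    have "ennreal (prob {\<omega> \<in> space M. Z n \<omega> \<notin> {0, 1}} + (1 - prob {\<omega> \<in> space M. Z n \<omega> = 0}))
        < ennreal (w + e / 2)"
      using prob_multiple_add_prob_nonzero_le[of "Z n"] Z elim(1) by (blast intro: le_less_trans)
    then have "prob {\<omega> \<in> space M. Z n \<omega> \<notin> {0, 1}} + (1 - prob {\<omega> \<in> space M. Z n \<omega> = 0}) < w + e / 2"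
      by (subst (asm) ennreal_less_iff) auto
    then show ?case
      using elim(2) one_minus_approx_exp[OF w] by linarith
  qed
qed

lemma poisson_process_measurable:
  assumes "poisson_process N Y lam" "Ebounded B"
  shows "(\<lambda>\<omega>. emeasure (Y \<omega>) B) \<in> borel_measurable N"
proof -
  interpret prob_space N
    using assms(1) by (simp add: poisson_process_def)
  have "indep_vars (\<lambda>_. borel) (\<lambda>i \<omega>. emeasure (Y \<omega>) B) {0 :: nat}"
    using assms unfolding poisson_process_def
    by (elim conjE allE[of _ "\<lambda>_ :: nat. B"] allE[of _ "{0 :: nat}"])
      (auto simp: disjoint_family_on_def)
  then show ?thesis
    by (simp add: indep_vars_def)
qed

lemma poisson_process_random_LFmeasure:
  assumes "poisson_process N Y lam"
  shows "random_LFmeasure N Y"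
  using assms poisson_process_measurable[OF assms Ebounded_grid_cell]
  unfolding random_LFmeasure_def random_LFmeasure_axioms_def poisson_process_def by blast

lemma poisson_process_prob_count:
  assumes "poisson_process N Y lam" "Ebounded B"
  shows "measure N {\<omega> \<in> space N. emeasure (Y \<omega>) B = of_nat i}
    = intensity lam B ^ i / fact i * exp (- intensity lam B)"
  using assms unfolding poisson_process_def by blast

lemma intensity_nonneg [simp]: "intensity lam B \<ge> 0"
  by (simp add: intensity_def)

lemma poisson_process_prob_multiple_le:
  assumes Y: "poisson_process N Y lam" and B: "Ebounded B"
  shows "measure N {\<omega> \<in> space N. emeasure (Y \<omega>) B \<notin> {0, 1}} \<le> (intensity lam B)\<^sup>2"
proof -
  interpret prob_space N
    using Y by (simp add: poisson_process_def)
  let ?E = "\<lambda>i::nat. {\<omega> \<in> space N. emeasure (Y \<omega>) B = of_nat i}" and ?w = "intensity lam B"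
  have E: "?E i \<in> events" for i
    using measurable_sets[OF poisson_process_measurable[OF Y B], of "{of_nat i}"]
    by (simp add: vimage_def Int_def conj_commute)
  have "(1 + ?w) * (1 - ?w) \<le> (1 + ?w) * exp (- ?w)"
    using exp_ge_add_one_self[of "- ?w"] by (intro mult_left_mono) auto
  then have exp_bound: "1 - (1 + ?w) * exp (- ?w) \<le> ?w\<^sup>2"
    by (simp add: algebra_simps power2_eq_square)
  have "{\<omega> \<in> space N. emeasure (Y \<omega>) B \<notin> {0, 1}} = space N - (?E 0 \<union> ?E 1)"
    by auto
  then have "prob {\<omega> \<in> space N. emeasure (Y \<omega>) B \<notin> {0, 1}} = 1 - prob (?E 0 \<union> ?E 1)"
    using prob_compl[OF sets.Un[OF E[of 0] E[of 1]]] by simp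
  also have "prob (?E 0 \<union> ?E 1) = prob (?E 0) + prob (?E 1)"
    by (rule finite_measure_Union[OF E E]) auto
  also have "\<dots> = (1 + ?w) * exp (- ?w)"
    using poisson_process_prob_count[OF Y B, of 0] poisson_process_prob_count[OF Y B, of 1]
    by (simp add: algebra_simps)
  finally show ?thesis
    using exp_bound by linarith
qed

lemma emeasure_UN_grid_cells_eq_0_iff:
  assumes "m \<in> LFmeasures" "finite A"
  shows "emeasure m (\<Union>k\<in>A. grid_cell a b k) = 0 \<longleftrightarrow> (\<forall>k\<in>A. emeasure m (grid_cell a b k) = 0)"
proof -
  have "emeasure m (\<Union>k\<in>A. grid_cell a b k) = (\<Sum>k\<in>A. emeasure m (grid_cell a b k))"
    using assms disjoint_grid_cell sets_LFmeasures by (intro sum_emeasure[symmetric]) auto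
  then show ?thesis
    using assms(2) by simp
qed

lemma (in random_LFmeasure) pattern_event_strips_eq:
  assumes "A \<subseteq> strips r K"
  shows "pattern_event M (\<lambda>k. {\<omega> \<in> space M. emeasure (X \<omega>) (strip_cell r K k) \<noteq> 0}) A {}
    = {\<omega> \<in> space M. emeasure (X \<omega>) (\<Union>k\<in>A. strip_cell r K k) = 0}"
  using emeasure_UN_grid_cells_eq_0_iff[OF X_LF finite_subset[OF assms finite_strips]]
  by (auto simp: pattern_event_def)

lemma tendsto_measure_occupied_strips:
  assumes X: "\<And>n. random_LFmeasure M (X n)" and Y: "random_LFmeasure N Y" and K: "K > 0"
    and void: "\<And>A. A \<subseteq> strips r K \<Longrightarrow>
      (\<lambda>n. measure M {\<omega> \<in> space M. emeasure (X n \<omega>) (\<Union>k\<in>A. strip_cell r K k) = 0})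
      \<longlonglongrightarrow> measure N {\<omega> \<in> space N. emeasure (Y \<omega>) (\<Union>k\<in>A. strip_cell r K k) = 0}"
  shows "(\<lambda>n. measure M {\<omega> \<in> space M. occupied_strips r K (X n \<omega>) \<in> \<D>})
    \<longlonglongrightarrow> measure N {\<omega> \<in> space N. occupied_strips r K (Y \<omega>) \<in> \<D>}"
proof -
  interpret X: random_LFmeasure M "X n" for n by fact
  interpret Y: random_LFmeasure N Y by fact
  let ?EX = "\<lambda>n k. {\<omega> \<in> space M. emeasure (X n \<omega>) (strip_cell r K k) \<noteq> 0}"
  let ?EY = "\<lambda>k. {\<omega> \<in> space N. emeasure (Y \<omega>) (strip_cell r K k) \<noteq> 0}"
  have "(\<lambda>n. measure M {\<omega> \<in> space M. {k \<in> strips r K. \<omega> \<in> ?EX n k} \<in> \<D>})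
    \<longlonglongrightarrow> measure N {\<omega> \<in> space N. {k \<in> strips r K. \<omega> \<in> ?EY k} \<in> \<D>}"
  proof (rule tendsto_measure_occupied_event)
    show "?EX n k \<in> sets M" "?EY k \<in> sets N" if "k \<in> strips r K" for n k
      using X.strip_event[OF K that, of "- {0}"] Y.strip_event[OF K that, of "- {0}"] by auto
  qed (use void X.pattern_event_strips_eq Y.pattern_event_strips_eq in
      \<open>auto intro: X.finite_measure_axioms Y.finite_measure_axioms\<close>)
  then show ?thesis
    by (simp add: occupied_strips_def cong: conj_cong)
qed

locale poisson_convergence =
  fixes M :: "'a measure" and X :: "nat \<Rightarrow> 'a \<Rightarrow> (real \<times> real) measure"
    and N :: "'b measure" and Y :: "'b \<Rightarrow> (real \<times> real) measure" and lam :: "real \<times> real \<Rightarrow> real"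
  assumes random_LFmeasure_X: "\<And>n. random_LFmeasure M (X n)"
    and poisson_Y: "poisson_process N Y lam"
    and count: "\<And>n a b k \<omega>. a > 0 \<Longrightarrow> b > 0 \<Longrightarrow> snd k \<ge> 1 \<Longrightarrow> \<omega> \<in> space M \<Longrightarrow>
      emeasure (X n \<omega>) (grid_cell a b k) \<in> \<nat>"
    and thin: "\<And>a b K k k'. a > 0 \<Longrightarrow> b > 0 \<Longrightarrow> K > 0 \<Longrightarrow> snd k \<ge> 1 \<Longrightarrow> k' \<in> refine_idx K 1 k \<Longrightarrow>
      intensity lam (grid_cell (a * K) b k') = intensity lam (grid_cell a b k) / real K"
    and mean: "\<And>a b k. a > 0 \<Longrightarrow> b > 0 \<Longrightarrow> snd k \<ge> 1 \<Longrightarrow>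
      (\<lambda>n. \<integral>\<^sup>+\<omega>. emeasure (X n \<omega>) (grid_cell a b k) \<partial>M) \<longlonglongrightarrow> ennreal (intensity lam (grid_cell a b k))"
    and void: "\<And>a b A. a > 0 \<Longrightarrow> b > 0 \<Longrightarrow> finite A \<Longrightarrow> (\<And>k. k \<in> A \<Longrightarrow> snd k \<ge> 1) \<Longrightarrow>
      (\<lambda>n. measure M {\<omega> \<in> space M. emeasure (X n \<omega>) (\<Union>k\<in>A. grid_cell a b k) = 0})
      \<longlonglongrightarrow> exp (- intensity lam (\<Union>k\<in>A. grid_cell a b k))"
begin

sublocale X: random_LFmeasure M "X n" for n
  by (rule random_LFmeasure_X)

sublocale Y: random_LFmeasure N Y
  by (rule poisson_process_random_LFmeasure[OF poisson_Y])

lemma tendsto_prob_occupied_strips: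
  assumes K: "K > 0"
  shows "(\<lambda>n. measure M {\<omega> \<in> space M. occupied_strips r K (X n \<omega>) \<in> \<D>})
    \<longlonglongrightarrow> measure N {\<omega> \<in> space N. occupied_strips r K (Y \<omega>) \<in> \<D>}"
proof (rule tendsto_measure_occupied_strips[OF random_LFmeasure_X Y.random_LFmeasure_axioms K])
  fix A assume A: "A \<subseteq> strips r K"
  then have "finite A" and snd: "\<And>k. k \<in> A \<Longrightarrow> snd k \<ge> 1"
    using finite_subset[OF A finite_strips] strips_snd_ge_1 by auto
  then have "Ebounded (\<Union>k\<in>A. strip_cell r K k)"
    using K by (intro Ebounded_UN Ebounded_grid_cell) auto
  from poisson_process_prob_count[OF poisson_Y this, of 0]
  have "measure N {\<omega> \<in> space N. emeasure (Y \<omega>) (\<Union>k\<in>A. strip_cell r K k) = 0}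
    = exp (- intensity lam (\<Union>k\<in>A. strip_cell r K k))"
    by simp
  then show "(\<lambda>n. measure M {\<omega> \<in> space M. emeasure (X n \<omega>) (\<Union>k\<in>A. strip_cell r K k) = 0})
    \<longlonglongrightarrow> measure N {\<omega> \<in> space N. emeasure (Y \<omega>) (\<Union>k\<in>A. strip_cell r K k) = 0}"
    using void[OF _ _ \<open>finite A\<close> snd, of "2 ^ r * K" "2 ^ r"] K by simp
qed

definition multiplicity_bound :: "nat \<Rightarrow> int \<times> int \<Rightarrow> real" where
  "multiplicity_bound r k = (intensity lam (dyadic_cell r k))\<^sup>2 + 1"

lemma strip_cell_bound:
  assumes "K > 0" "k \<in> window r" "k' \<in> refine_idx K 1 k"
  shows "(intensity lam (strip_cell r K k'))\<^sup>2 + 1 / (real K)\<^sup>2 = multiplicity_bound r k / (real K)\<^sup>2"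
    and "snd k' \<ge> 1"
  using assms thin[of "2 ^ r" "2 ^ r" K k k'] window_snd_ge_1[of k r] snd_refine_idx_ge_1[of k' K 1 k]
  by (auto simp: multiplicity_bound_def power_divide add_divide_distrib)

lemma prob_Y_not_simple_le:
  assumes K: "K > 0"
  shows "measure N {\<omega> \<in> space N. \<not> simple_on_strips r K (Y \<omega>)}
    \<le> (\<Sum>k\<in>window r. multiplicity_bound r k) / real K"
proof (rule Y.prob_not_simple_le[OF K])
  fix k k' assume k: "k \<in> window r" "k' \<in> refine_idx K 1 k"
  have "measure N {\<omega> \<in> space N. emeasure (Y \<omega>) (strip_cell r K k') \<notin> {0, 1}}
      \<le> (intensity lam (strip_cell r K k'))\<^sup>2"
    using strip_cell_bound(2)[OF K k] K
    by (intro poisson_process_prob_multiple_le[OF poisson_Y] Ebounded_grid_cell) auto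
  also have "\<dots> \<le> multiplicity_bound r k / (real K)\<^sup>2"
    unfolding strip_cell_bound(1)[OF K k, symmetric] by simp
  finally show "measure N {\<omega> \<in> space N. emeasure (Y \<omega>) (strip_cell r K k') \<notin> {0, 1}}
      \<le> multiplicity_bound r k / (real K)\<^sup>2" .
qed

lemma eventually_prob_X_not_simple_le:
  assumes K: "K > 0"
  shows "\<forall>\<^sub>F n in sequentially. measure M {\<omega> \<in> space M. \<not> simple_on_strips r K (X n \<omega>)}
    \<le> (\<Sum>k\<in>window r. multiplicity_bound r k) / real K"
proof -
  have "\<forall>\<^sub>F n in sequentially. \<forall>k\<in>window r. \<forall>k'\<in>refine_idx K 1 k.
    measure M {\<omega> \<in> space M. emeasure (X n \<omega>) (strip_cell r K k') \<notin> {0, 1}}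
      < multiplicity_bound r k / (real K)\<^sup>2"
  proof (intro eventually_ball_finite ballI finite_window finite_refine_idx)
    fix k k' assume k: "k \<in> window r" "k' \<in> refine_idx K 1 k"
    have "2 ^ r * K > 0" "(2 ^ r :: nat) > 0"
      using K by auto
    note cell = this strip_cell_bound(2)[OF K k]
    show "\<forall>\<^sub>F n in sequentially.
      measure M {\<omega> \<in> space M. emeasure (X n \<omega>) (strip_cell r K k') \<notin> {0, 1}}
        < multiplicity_bound r k / (real K)\<^sup>2"
      unfolding strip_cell_bound(1)[OF K k, symmetric]
    proof (rule X.eventually_prob_multiple_less[OF X.emeasure_X_measurable[OF cell] count[OF cell]
          mean[OF cell]])
      show "(\<lambda>n. measure M {\<omega> \<in> space M. emeasure (X n \<omega>) (strip_cell r K k') = 0})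
        \<longlonglongrightarrow> exp (- intensity lam (strip_cell r K k'))"
        using void[OF cell(1,2), of "{k'}"] cell(3) by simp
    qed (use K in auto)
  qed
  then show ?thesis
    by eventually_elim (intro X.prob_not_simple_le K, auto intro: less_imp_le)
qed

theorem vague_convergence: "conv_distr_vague M X N Y"
proof (rule conv_distr_vague_if_liminf_open[OF random_LFmeasure_X Y.random_LFmeasure_axioms],
    rule vague_liminf_open[OF random_LFmeasure_X Y.random_LFmeasure_axioms
      tendsto_prob_occupied_strips])
  fix r :: nat and e :: real assume e: "e > 0"
  let ?\<beta> = "\<Sum>k\<in>window r. multiplicity_bound r k"
  obtain K :: nat where large: "?\<beta> / e < real K"
    using reals_Archimedean2 by blast
  moreover have "?\<beta> / e \<ge> 0"
    unfolding multiplicity_bound_def using e by (intro divide_nonneg_pos sum_nonneg) auto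
  ultimately have K: "K > 0"
    by (metis le_less_trans of_nat_0_less_iff)
  with large e have "?\<beta> / real K < e"
    by (simp add: field_simps)
  then show "\<exists>K>0. measure N {\<omega> \<in> space N. \<not> simple_on_strips r K (Y \<omega>)} < e \<and>
    (\<forall>\<^sub>F n in sequentially. measure M {\<omega> \<in> space M. \<not> simple_on_strips r K (X n \<omega>)} < e)"
    using K prob_Y_not_simple_le[OF K, of r] eventually_prob_X_not_simple_le[OF K, of r]
    by (intro exI[of _ K]) (auto elim: eventually_mono)
qed

end

section \<open>One-dependent events\<close>

lemma prod_one_minus_approx_exp:
  fixes p :: "'i \<Rightarrow> real"
  assumes p: "\<And>i. i \<in> I \<Longrightarrow> 0 \<le> p i" "\<And>i. i \<in> I \<Longrightarrow> p i \<le> 1" "\<And>i. i \<in> I \<Longrightarrow> p i \<le> b"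
  shows "\<bar>(\<Prod>i\<in>I. 1 - p i) - exp (- (\<Sum>i\<in>I. p i))\<bar> \<le> real (card I) * b\<^sup>2"
proof (cases "finite I")
  case True
  have "\<bar>(\<Prod>i\<in>I. 1 - p i) - (\<Prod>i\<in>I. exp (- p i))\<bar> \<le> (\<Sum>i\<in>I. \<bar>(1 - p i) - exp (- p i)\<bar>)"
    using norm_prod_diff[of I "\<lambda>i. 1 - p i" "\<lambda>i. exp (- p i)"] p by auto
  also have "\<dots> \<le> (\<Sum>i\<in>I. b\<^sup>2)"
    using p by (intro sum_mono order_trans[OF one_minus_approx_exp] power_mono) auto
  finally show ?thesis
    using True by (simp add: exp_sum flip: sum_negf)
qed simp

locale one_dependent_events = prob_space M for M :: "'a measure" +
  fixes E :: "nat \<Rightarrow> 'a set" and s p :: real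
  assumes E_event [measurable]: "E i \<in> events"
    and one_dependent: "prob ((space M - (\<Union>i<k. E i)) \<inter> E (Suc k))
      = prob (space M - (\<Union>i<k. E i)) * prob (E (Suc k))"
    and prob_E_Int_le: "prob (E i \<inter> E (Suc i)) \<le> s"
    and prob_E_le: "prob (E i) \<le> p"
begin

abbreviation void :: "nat \<Rightarrow> 'a set" where
  "void k \<equiv> space M - (\<Union>i<k. E i)"

lemma void_Suc: "void (Suc k) = void k - void k \<inter> E k"
  by (auto simp: less_Suc_eq)

lemma prob_void_Suc_Int:
  assumes "A \<in> events"
  shows "prob (void (Suc k) \<inter> A) = prob (void k \<inter> A) - prob (void k \<inter> E k \<inter> A)"
proof -
  have "void (Suc k) \<inter> A = void k \<inter> A - void k \<inter> E k \<inter> A"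
    by (auto simp: void_Suc)
  then show ?thesis
    using assms by (simp add: finite_measure_Diff Int_assoc le_infI2)
qed

lemma prob_void_Suc: "prob (void (Suc k)) = prob (void k) - prob (void k \<inter> E k)"
  unfolding void_Suc by (intro finite_measure_Diff) auto

text \<open>One-dependence makes \<^term>\<open>E (Suc k)\<close> independent of \<^term>\<open>void k\<close> rather than of
  \<^term>\<open>void (Suc k)\<close>. Removing \<^term>\<open>E k\<close> costs at most the probability that two neighbours
  occur together.\<close>

lemma prob_void_Int_approx: "\<bar>prob (void k \<inter> E k) - prob (void k) * prob (E k)\<bar> \<le> s + p\<^sup>2"
proof (cases k)
  case 0
  have "s \<ge> 0"
    using prob_E_Int_le[of 0] measure_nonneg order_trans by blast
  then show ?thesis
    using 0 by (simp add: prob_space)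
next
  case (Suc j)
  have p_nonneg: "p \<ge> 0"
    using prob_E_le[of 0] measure_nonneg order_trans by blast
  have "prob (void k \<inter> E k) - prob (void k) * prob (E k)
      = prob (void j \<inter> E j) * prob (E k) - prob (void j \<inter> E j \<inter> E k)"
    unfolding Suc prob_void_Suc prob_void_Suc_Int[OF E_event] one_dependent
    by (simp add: algebra_simps)
  moreover have "prob (void j \<inter> E j \<inter> E k) \<le> s"
    unfolding Suc by (intro order_trans[OF finite_measure_mono prob_E_Int_le[of j]]) auto
  moreover have "prob (void j \<inter> E j) * prob (E k) \<le> p\<^sup>2"
    unfolding power2_eq_square using p_nonneg
    by (intro mult_mono prob_E_le order_trans[OF finite_measure_mono prob_E_le[of j]]) auto
  moreover have "prob (void j \<inter> E j) * prob (E k) \<ge> 0" "prob (void j \<inter> E j \<inter> E k) \<ge> 0"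
    by auto
  ultimately show ?thesis
    using zero_le_power2[of p] by linarith
qed

lemma prob_void_approx_prod: "\<bar>prob (void m) - (\<Prod>i<m. 1 - prob (E i))\<bar> \<le> real m * (s + p\<^sup>2)"
proof (induction m)
  case 0
  show ?case
    by (simp add: prob_space)
next
  case (Suc m)
  have "prob (void (Suc m)) - (\<Prod>i<Suc m. 1 - prob (E i)) =
    (prob (void m) - (\<Prod>i<m. 1 - prob (E i))) * (1 - prob (E m))
      - (prob (void m \<inter> E m) - prob (void m) * prob (E m))"
    unfolding prob_void_Suc by (simp add: algebra_simps)
  also have "\<bar>\<dots>\<bar> \<le> \<bar>(prob (void m) - (\<Prod>i<m. 1 - prob (E i))) * (1 - prob (E m))\<bar> + (s + p\<^sup>2)"
    using prob_void_Int_approx[of m] by linarith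
  also have "\<bar>(prob (void m) - (\<Prod>i<m. 1 - prob (E i))) * (1 - prob (E m))\<bar>
      \<le> \<bar>prob (void m) - (\<Prod>i<m. 1 - prob (E i))\<bar> * 1"
    unfolding abs_mult
    by (intro mult_left_mono) (auto simp: abs_le_iff intro: order_trans[OF prob_le_1])
  finally show ?case
    using Suc.IH by (simp add: algebra_simps)
qed

theorem prob_void_approx_exp:
  "\<bar>prob (void m) - exp (- (\<Sum>i<m. prob (E i)))\<bar> \<le> real m * (s + 2 * p\<^sup>2)"
proof -
  have "\<bar>(\<Prod>i<m. 1 - prob (E i)) - exp (- (\<Sum>i<m. prob (E i)))\<bar> \<le> real m * p\<^sup>2"
    using prod_one_minus_approx_exp[of "{..<m}" "\<lambda>i. prob (E i)" p] prob_E_le by simp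
  then show ?thesis
    using prob_void_approx_prod[of m] by (simp add: algebra_simps)
qed

end

section \<open>Scaled point processes on the integers\<close>

definition scaled_pp :: "real \<Rightarrow> real \<Rightarrow> (int \<Rightarrow> real) \<Rightarrow> (real \<times> real) measure" where
  "scaled_pp \<alpha> \<beta> u = distr (count_space {x. (\<alpha> * real_of_int x, \<beta> * u x) \<in> Espace}) borel
     (\<lambda>x. (\<alpha> * real_of_int x, \<beta> * u x))"

definition sites :: "real \<Rightarrow> real \<Rightarrow> real \<Rightarrow> int set" where
  "sites \<alpha> v w = {x. \<alpha> * real_of_int x \<in> {v..<w}}"

lemma sites_eq:
  assumes "\<alpha> > 0"
  shows "sites \<alpha> v w = {\<lceil>v / \<alpha>\<rceil>..<\<lceil>w / \<alpha>\<rceil>}"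
  using assms by (auto simp: sites_def ceiling_le_iff less_ceiling_iff field_simps)

lemma finite_sites: "\<alpha> > 0 \<Longrightarrow> finite (sites \<alpha> v w)"
  by (simp add: sites_eq)

lemma card_sites_approx:
  assumes "\<alpha> > 0" "v \<le> w"
  shows "\<bar>\<alpha> * real (card (sites \<alpha> v w)) - (w - v)\<bar> \<le> \<alpha>"
proof -
  have "v / \<alpha> \<le> w / \<alpha>"
    using assms by (simp add: divide_right_mono)
  then have "real (card (sites \<alpha> v w)) = real_of_int \<lceil>w / \<alpha>\<rceil> - real_of_int \<lceil>v / \<alpha>\<rceil>"
    using ceiling_mono[of "v / \<alpha>" "w / \<alpha>"] by (simp add: sites_eq[OF assms(1)])
  then have "\<bar>real (card (sites \<alpha> v w)) - (w / \<alpha> - v / \<alpha>)\<bar> \<le> 1"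
    by linarith
  then have "\<alpha> * \<bar>real (card (sites \<alpha> v w)) - (w / \<alpha> - v / \<alpha>)\<bar> \<le> \<alpha> * 1"
    using assms by (intro mult_left_mono) auto
  also have "\<alpha> * \<bar>real (card (sites \<alpha> v w)) - (w / \<alpha> - v / \<alpha>)\<bar>
      = \<bar>\<alpha> * real (card (sites \<alpha> v w)) - (w - v)\<bar>"
    using assms by (simp add: abs_mult_pos' right_diff_distrib)
  finally show ?thesis
    by simp
qed

lemma tendsto_scaled_card_sites:
  assumes "\<And>n. \<alpha> n > 0" "\<alpha> \<longlonglongrightarrow> 0" "v \<le> w"
  shows "(\<lambda>n. \<alpha> n * real (card (sites (\<alpha> n) v w))) \<longlonglongrightarrow> w - v"
proof -
  have "(\<lambda>n. \<alpha> n * real (card (sites (\<alpha> n) v w)) - (w - v)) \<longlonglongrightarrow> 0"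
    using card_sites_approx assms by (intro Lim_null_comparison[OF _ assms(2)]) auto
  then show ?thesis
    by (rule LIM_zero_cancel)
qed

lemma sum_indicator_eq_of_nat_card:
  "finite S \<Longrightarrow> (\<Sum>x\<in>S. indicator C (f x)) = of_nat (card {x \<in> S. f x \<in> C})"
  by (simp add: indicator_def sum.If_cases Int_def)

lemma emeasure_scaled_pp:
  assumes \<alpha>: "\<alpha> > 0" and C: "C \<in> sets borel" "C \<subseteq> Espace" "C \<subseteq> {v..<w} \<times> UNIV"
  shows "emeasure (scaled_pp \<alpha> \<beta> u) C
    = (\<Sum>x\<in>sites \<alpha> v w. indicator C (\<alpha> * real_of_int x, \<beta> * u x))"
proof -
  let ?pt = "\<lambda>x. (\<alpha> * real_of_int x, \<beta> * u x)"
  let ?S = "{x \<in> sites \<alpha> v w. ?pt x \<in> C}"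
  have "?pt -` C \<inter> {x. ?pt x \<in> Espace} = ?S"
    using C by (auto simp: sites_def)
  then have "emeasure (scaled_pp \<alpha> \<beta> u) C = emeasure (count_space {x. ?pt x \<in> Espace}) ?S"
    unfolding scaled_pp_def using C(1) by (subst emeasure_distr) auto
  also have "\<dots> = of_nat (card ?S)"
    using C(2) finite_sites[OF \<alpha>] by (subst emeasure_count_space) auto
  finally show ?thesis
    using finite_sites[OF \<alpha>] by (simp add: sum_indicator_eq_of_nat_card)
qed

lemma dyadic_box_subset: "dyadic_box r \<subseteq> Espace" "dyadic_box r \<subseteq> {- real r..<real r} \<times> UNIV"
  using less_le_trans[of 0 "1 / 2 ^ r :: real"] by (auto simp: dyadic_box_def Espace_def)

lemma grid_cell_subset:
  assumes "a > 0" "b > 0" "snd k \<ge> 1"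
  shows "grid_cell a b k \<subseteq> Espace"
    and "grid_cell a b k \<subseteq> {real_of_int (fst k) / real a..<(real_of_int (fst k) + 1) / real a} \<times> UNIV"
  using Ebounded_grid_cell[OF assms] grid_cell_eq_Times[OF assms(1,2)]
  by (auto simp: Ebounded_def)

lemma scaled_pp_LFmeasures:
  assumes "\<alpha> > 0"
  shows "scaled_pp \<alpha> \<beta> u \<in> LFmeasures"
proof -
  let ?m = "scaled_pp \<alpha> \<beta> u"
  have sets: "sets ?m = sets borel"
    by (simp add: scaled_pp_def)
  have "open Espace"
    unfolding Espace_def by (intro open_Times) auto
  moreover have "(\<lambda>x. (\<alpha> * real_of_int x, \<beta> * u x)) -` (- Espace)
    \<inter> {x. (\<alpha> * real_of_int x, \<beta> * u x) \<in> Espace} = {}"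
    by auto
  ultimately have "emeasure ?m (- Espace) = 0"
    unfolding scaled_pp_def by (subst emeasure_distr) auto
  moreover have "emeasure ?m K < \<infinity>" if K: "compact K" "K \<subseteq> Espace" for K
  proof -
    obtain r where "K \<subseteq> dyadic_box r"
      using compact_subset_dyadic_box[OF K] by blast
    moreover have box: "dyadic_box r \<in> sets borel"
      using Ebounded_dyadic_box by (simp add: Ebounded_def)
    ultimately have "emeasure ?m K \<le> emeasure ?m (dyadic_box r)"
      by (intro emeasure_mono) (auto simp: sets)
    also have "\<dots> < \<infinity>"
      unfolding emeasure_scaled_pp[OF assms box dyadic_box_subset]
        sum_indicator_eq_of_nat_card[OF finite_sites[OF assms]]
      by (simp add: of_nat_less_top)
    finally show ?thesis .
  qed
  ultimately show ?thesis
    unfolding LFmeasures_def using sets by blast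
qed

lemma emeasure_scaled_pp_grid_cell_Nats:
  assumes "\<alpha> > 0" "a > 0" "b > 0" "snd k \<ge> 1"
  shows "emeasure (scaled_pp \<alpha> \<beta> u) (grid_cell a b k) \<in> \<nat>"
  unfolding emeasure_scaled_pp[OF assms(1) sets_grid_cell grid_cell_subset[OF assms(2-4)]]
    sum_indicator_eq_of_nat_card[OF finite_sites[OF assms(1)]]
  by simp

section \<open>One-dependent stationary sequences\<close>

locale one_dependent_sequence = prob_space M for M :: "'a measure" +
  fixes d :: "int \<Rightarrow> 'a \<Rightarrow> real"
  assumes d_measurable [measurable]: "d x \<in> borel_measurable M"
    and d_stationary: "distr M borel (d x) = distr M borel (d 0)"
    and d_one_dependent: "indep_var (PiM {..x} (\<lambda>_. borel)) (\<lambda>\<omega>. \<lambda>y\<in>{..x}. d y \<omega>)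
      (PiM {x + 2..} (\<lambda>_. borel)) (\<lambda>\<omega>. \<lambda>y\<in>{x + 2..}. d y \<omega>)"
begin

lemma prob_d_stationary:
  assumes "B \<in> sets borel"
  shows "prob {\<omega> \<in> space M. d x \<omega> \<in> B} = prob {\<omega> \<in> space M. d 0 \<omega> \<in> B}"
proof -
  have "prob {\<omega> \<in> space M. d y \<omega> \<in> B} = measure (distr M borel (d y)) B" for y
    using assms by (simp add: measure_distr vimage_def Int_def conj_commute)
  then show ?thesis
    using d_stationary by metis
qed

lemma one_dependent_membership_events:
  assumes B [measurable]: "\<And>x. B x \<in> sets borel"
    and s: "\<And>x. prob {\<omega> \<in> space M. d x \<omega> \<in> B x \<and> d (x + 1) \<omega> \<in> B (x + 1)} \<le> s"
    and p: "\<And>x. prob {\<omega> \<in> space M. d x \<omega> \<in> B x} \<le> p"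
  shows "one_dependent_events M (\<lambda>i. {\<omega> \<in> space M. d (l + int i) \<omega> \<in> B (l + int i)}) s p"
proof
  let ?E = "\<lambda>i. {\<omega> \<in> space M. d (l + int i) \<omega> \<in> B (l + int i)}"
  show "?E i \<in> events" for i
    by measurable
  show "prob (?E i) \<le> p" for i
    by (rule p)
  have "?E i \<inter> ?E (Suc i) = {\<omega> \<in> space M. d (l + int i) \<omega> \<in> B (l + int i)
    \<and> d (l + int i + 1) \<omega> \<in> B (l + int i + 1)}" for i
    by (auto simp: algebra_simps)
  then show "prob (?E i \<inter> ?E (Suc i)) \<le> s" for i
    using s by simp
  fix k
  define x where "x = l + int k - 1"
  let ?past = "\<lambda>\<omega>. \<lambda>y\<in>{..x}. d y \<omega>" and ?future = "\<lambda>\<omega>. \<lambda>y\<in>{x + 2..}. d y \<omega>"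
  let ?P = "{f \<in> space (PiM {..x} (\<lambda>_. borel)). \<forall>i\<in>{..<k}. f (l + int i) \<notin> B (l + int i)}"
  let ?Q = "{f \<in> space (PiM {x + 2..} (\<lambda>_. borel)). f (x + 2) \<in> B (x + 2)}"
  have component: "{f \<in> space (PiM A (\<lambda>_. borel)). f y \<in> B y} \<in> sets (PiM A (\<lambda>_. borel))"
    if "y \<in> A" for y A
    using that by measurable
  have "?P \<in> sets (PiM {..x} (\<lambda>_. borel))" "?Q \<in> sets (PiM {x + 2..} (\<lambda>_. borel))"
    by (intro sets.sets_Collect_finite_All sets.sets_Collect_neg component; auto simp: x_def)+
  from indep_varD[OF d_one_dependent this]
  have "prob ((\<lambda>\<omega>. (?past \<omega>, ?future \<omega>)) -` (?P \<times> ?Q) \<inter> space M)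
    = prob (?past -` ?P \<inter> space M) * prob (?future -` ?Q \<inter> space M)" .
  moreover have "?past -` ?P \<inter> space M = space M - (\<Union>i<k. ?E i)"
    by (auto simp: x_def space_PiM)
  moreover have "?future -` ?Q \<inter> space M = ?E (Suc k)"
    by (auto simp: x_def space_PiM algebra_simps)
  moreover have "(\<lambda>\<omega>. (?past \<omega>, ?future \<omega>)) -` (?P \<times> ?Q) \<inter> space M
    = (?past -` ?P \<inter> space M) \<inter> (?future -` ?Q \<inter> space M)"
    by (simp only: set_eq_iff vimage_eq Int_iff mem_Times_iff fst_conv snd_conv) blast
  ultimately show "prob ((space M - (\<Union>i<k. ?E i)) \<inter> ?E (Suc k))
    = prob (space M - (\<Union>i<k. ?E i)) * prob (?E (Suc k))"
    by simp
qed

lemma prob_void_interval_approx_exp: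
  assumes B: "\<And>x. B x \<in> sets borel"
    and s: "\<And>x. prob {\<omega> \<in> space M. d x \<omega> \<in> B x \<and> d (x + 1) \<omega> \<in> B (x + 1)} \<le> s"
    and p: "\<And>x. prob {\<omega> \<in> space M. d x \<omega> \<in> B x} \<le> p"
  shows "\<bar>prob {\<omega> \<in> space M. \<forall>x\<in>{l..<u}. d x \<omega> \<notin> B x}
    - exp (- (\<Sum>x\<in>{l..<u}. prob {\<omega> \<in> space M. d x \<omega> \<in> B x}))\<bar> \<le> real (card {l..<u}) * (s + 2 * p\<^sup>2)"
proof -
  interpret E: one_dependent_events M "\<lambda>i. {\<omega> \<in> space M. d (l + int i) \<omega> \<in> B (l + int i)}" s p
    by (rule one_dependent_membership_events[OF assms])
  have bij: "bij_betw (\<lambda>i. l + int i) {..<nat (u - l)} {l..<u}"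
    by (rule bij_betwI[where g = "\<lambda>x. nat (x - l)"]) auto
  have "E.void (nat (u - l)) = {\<omega> \<in> space M. \<forall>x\<in>{l..<u}. d x \<omega> \<notin> B x}"
    unfolding bij_betw_imp_surj_on[OF bij, symmetric] by auto
  then show ?thesis
    using E.prob_void_approx_exp[of "nat (u - l)"]
      sum.reindex_bij_betw[OF bij, of "\<lambda>x. prob {\<omega> \<in> space M. d x \<omega> \<in> B x}"]
    by simp
qed

context
  fixes \<alpha> \<beta> :: real
  assumes \<alpha>: "\<alpha> > 0"
begin

abbreviation pp :: "'a \<Rightarrow> (real \<times> real) measure" where
  "pp \<omega> \<equiv> scaled_pp \<alpha> \<beta> (\<lambda>x. d x \<omega>)"

lemma point_measurable: "(\<lambda>\<omega>. (\<alpha> * real_of_int x, \<beta> * d x \<omega>)) \<in> borel_measurable M"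
  by measurable

lemma point_event:
  assumes "C \<in> sets borel"
  shows "{\<omega> \<in> space M. (\<alpha> * real_of_int x, \<beta> * d x \<omega>) \<in> C} \<in> events"
  using measurable_sets[OF point_measurable assms, of x]
  by (simp add: vimage_def Int_def conj_commute)

lemma indicator_point_measurable:
  assumes "C \<in> sets borel"
  shows "(\<lambda>\<omega>. indicator C (\<alpha> * real_of_int x, \<beta> * d x \<omega>) :: ennreal) \<in> borel_measurable M"
  by (rule measurable_compose[OF point_measurable borel_measurable_indicator[OF assms]])

lemma pp_random_LFmeasure: "random_LFmeasure M pp"
proof
  fix a b :: nat and k :: "int \<times> int"
  assume cell: "a > 0" "b > 0" "snd k \<ge> 1"
  show "(\<lambda>\<omega>. emeasure (pp \<omega>) (grid_cell a b k)) \<in> borel_measurable M"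
    unfolding emeasure_scaled_pp[OF \<alpha> sets_grid_cell grid_cell_subset[OF cell]]
    by (intro borel_measurable_sum indicator_point_measurable sets_grid_cell)
qed (rule scaled_pp_LFmeasures[OF \<alpha>])

lemma nn_integral_emeasure_pp:
  assumes C: "C \<in> sets borel" "C \<subseteq> Espace" "C \<subseteq> {v..<w} \<times> UNIV"
  shows "(\<integral>\<^sup>+\<omega>. emeasure (pp \<omega>) C \<partial>M)
    = ennreal (\<Sum>x\<in>sites \<alpha> v w. prob {\<omega> \<in> space M. (\<alpha> * real_of_int x, \<beta> * d x \<omega>) \<in> C})"
proof -
  have "(\<integral>\<^sup>+\<omega>. indicator C (\<alpha> * real_of_int x, \<beta> * d x \<omega>) \<partial>M)
      = ennreal (prob {\<omega> \<in> space M. (\<alpha> * real_of_int x, \<beta> * d x \<omega>) \<in> C})" for x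
  proof -
    have "(\<integral>\<^sup>+\<omega>. indicator C (\<alpha> * real_of_int x, \<beta> * d x \<omega>) \<partial>M)
      = (\<integral>\<^sup>+\<omega>. indicator {\<omega> \<in> space M. (\<alpha> * real_of_int x, \<beta> * d x \<omega>) \<in> C} \<omega> \<partial>M)"
      by (intro nn_integral_cong) (simp add: indicator_def)
    then show ?thesis
      using point_event[OF C(1)] by (simp add: emeasure_eq_measure)
  qed
  then show ?thesis
    unfolding emeasure_scaled_pp[OF \<alpha> C] using indicator_point_measurable[OF C(1)]
    by (subst nn_integral_sum) (auto simp: sum_ennreal)
qed

lemma prob_pp_void_approx_exp:
  assumes C: "C \<in> sets borel" "C \<subseteq> Espace" "C \<subseteq> {v..<w} \<times> {..<t}"
    and s: "\<And>x. prob {\<omega> \<in> space M. \<beta> * d x \<omega> < t \<and> \<beta> * d (x + 1) \<omega> < t} \<le> s"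
    and p: "prob {\<omega> \<in> space M. \<beta> * d 0 \<omega> < t} = p"
  shows "\<bar>prob {\<omega> \<in> space M. emeasure (pp \<omega>) C = 0}
      - exp (- enn2real (\<integral>\<^sup>+\<omega>. emeasure (pp \<omega>) C \<partial>M))\<bar>
    \<le> real (card (sites \<alpha> v w)) * (s + 2 * p\<^sup>2)"
proof -
  define B where "B x = {y. (\<alpha> * real_of_int x, \<beta> * y) \<in> C}" for x
  have C': "C \<subseteq> {v..<w} \<times> UNIV"
    using C(3) by auto
  have B: "B x \<in> sets borel" for x
  proof -
    have "(\<lambda>y. (\<alpha> * real_of_int x, \<beta> * y)) \<in> borel_measurable (borel :: real measure)"
      by measurable
    from measurable_sets[OF this C(1)] show ?thesis
      by (simp add: B_def vimage_def)
  qed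
  have below: "\<beta> * y < t" if "y \<in> B x" for x y
    using that C(3) by (auto simp: B_def)
  have "prob {\<omega> \<in> space M. d x \<omega> \<in> B x \<and> d (x + 1) \<omega> \<in> B (x + 1)} \<le> s" for x
    using below by (intro order_trans[OF finite_measure_mono s[of x]]) auto
  moreover have "prob {\<omega> \<in> space M. d x \<omega> \<in> B x} \<le> p" for x
  proof -
    have "prob {\<omega> \<in> space M. d x \<omega> \<in> B x} \<le> prob {\<omega> \<in> space M. d x \<omega> \<in> {y. \<beta> * y < t}}"
      using below by (intro finite_measure_mono) auto
    then show ?thesis
      using p prob_d_stationary[of "{y. \<beta> * y < t}" x] by simp
  qed
  ultimately have approx: "\<bar>prob {\<omega> \<in> space M. \<forall>x\<in>sites \<alpha> v w. d x \<omega> \<notin> B x}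
      - exp (- (\<Sum>x\<in>sites \<alpha> v w. prob {\<omega> \<in> space M. d x \<omega> \<in> B x}))\<bar>
    \<le> real (card (sites \<alpha> v w)) * (s + 2 * p\<^sup>2)"
    unfolding sites_eq[OF \<alpha>] by (intro prob_void_interval_approx_exp B)
  have "emeasure (pp \<omega>) C = 0 \<longleftrightarrow> (\<forall>x\<in>sites \<alpha> v w. d x \<omega> \<notin> B x)" for \<omega>
    unfolding emeasure_scaled_pp[OF \<alpha> C(1,2) C'] using finite_sites[OF \<alpha>]
    by (simp add: B_def indicator_eq_0_iff)
  then show ?thesis
    using approx unfolding nn_integral_emeasure_pp[OF C(1,2) C'] B_def
    by (simp add: sum_nonneg)
qed

end

end

section \<open>Intensities depending on the height only\<close>

lemma nn_integral_Times_snd: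
  fixes g :: "real \<Rightarrow> real"
  assumes [measurable]: "g \<in> borel_measurable borel" "J \<in> sets borel" and "v \<le> w"
  shows "(\<integral>\<^sup>+z\<in>{v..<w} \<times> J. ennreal (g (snd z)) \<partial>lborel)
    = ennreal (w - v) * (\<integral>\<^sup>+y\<in>J. ennreal (g y) \<partial>lborel)"
proof -
  have "(\<integral>\<^sup>+z\<in>{v..<w} \<times> J. ennreal (g (snd z)) \<partial>lborel)
    = (\<integral>\<^sup>+x. \<integral>\<^sup>+y. indicator {v..<w} x * (ennreal (g y) * indicator J y) \<partial>lborel \<partial>lborel)"
    unfolding lborel_prod[symmetric]
    by (subst lborel.nn_integral_fst[symmetric]) (simp_all add: indicator_times mult_ac)
  also have "\<dots> = (\<integral>\<^sup>+x. (\<integral>\<^sup>+y\<in>J. ennreal (g y) \<partial>lborel) * indicator {v..<w} x \<partial>lborel)"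
    by (simp add: nn_integral_cmult mult.commute)
  also have "\<dots> = ennreal (w - v) * (\<integral>\<^sup>+y\<in>J. ennreal (g y) \<partial>lborel)"
    using \<open>v \<le> w\<close> by (subst nn_integral_cmult_indicator) (simp_all add: mult.commute)
  finally show ?thesis .
qed

lemma intensity_UN:
  assumes lam: "lam \<in> borel_measurable borel" and A: "finite A" "disjoint_family_on B A"
    and B: "\<And>k. k \<in> A \<Longrightarrow> B k \<in> sets borel" "\<And>k. k \<in> A \<Longrightarrow> (\<integral>\<^sup>+z\<in>B k. ennreal (lam z) \<partial>lborel) < \<infinity>"
  shows "intensity lam (\<Union>k\<in>A. B k) = (\<Sum>k\<in>A. intensity lam (B k))"
proof -
  let ?D = "density lborel (\<lambda>z. ennreal (lam z))"
  have D: "(\<integral>\<^sup>+z\<in>C. ennreal (lam z) \<partial>lborel) = emeasure ?D C" if "C \<in> sets borel" for C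
    using lam that by (intro emeasure_density[symmetric]) auto
  have "(\<integral>\<^sup>+z\<in>(\<Union>k\<in>A. B k). ennreal (lam z) \<partial>lborel) = emeasure ?D (\<Union>k\<in>A. B k)"
    using A(1) B(1) by (intro D) auto
  also have "\<dots> = (\<Sum>k\<in>A. \<integral>\<^sup>+z\<in>B k. ennreal (lam z) \<partial>lborel)"
    using A B(1) by (subst sum_emeasure[symmetric]) (auto simp: D)
  finally show ?thesis
    unfolding intensity_def using B(2) by (simp add: enn2real_sum)
qed

section \<open>Poisson limit of one-dependent sequences\<close>

locale one_dependent_scheme = one_dependent_sequence M d
  for M :: "'a measure" and d :: "int \<Rightarrow> 'a \<Rightarrow> real" +
  fixes \<alpha> \<beta> :: "nat \<Rightarrow> real" and \<Lambda> g :: "real \<Rightarrow> real"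
  assumes \<alpha>_pos: "\<alpha> n > 0" and \<alpha>_tendsto_0: "\<alpha> \<longlonglongrightarrow> 0"
    and tail: "t > 0 \<Longrightarrow> (\<lambda>n. prob {\<omega> \<in> space M. \<beta> n * d 0 \<omega> < t} / \<alpha> n) \<longlonglongrightarrow> \<Lambda> t"
    and cluster: "t > 0 \<Longrightarrow> \<exists>s. (\<lambda>n. s n / \<alpha> n) \<longlonglongrightarrow> 0 \<and>
      (\<forall>n x. prob {\<omega> \<in> space M. \<beta> n * d x \<omega> < t \<and> \<beta> n * d (x + 1) \<omega> < t} \<le> s n)"
    and g_measurable [measurable]: "g \<in> borel_measurable borel"
    and g_integral: "0 < s \<Longrightarrow> s \<le> t \<Longrightarrow> (\<integral>\<^sup>+y\<in>{s..<t}. ennreal (g y) \<partial>lborel) = ennreal (\<Lambda> t - \<Lambda> s)"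
begin

abbreviation height_intensity :: "real \<times> real \<Rightarrow> real" where
  "height_intensity \<equiv> \<lambda>(x, y). g y"

definition cell_weight :: "nat \<Rightarrow> int \<Rightarrow> real" where
  "cell_weight b j = \<Lambda> ((real_of_int j + 1) / real b) - \<Lambda> (real_of_int j / real b)"

lemma \<Lambda>_mono:
  assumes "0 < s" "s \<le> t"
  shows "\<Lambda> s \<le> \<Lambda> t"
proof (rule LIMSEQ_le[OF tail tail])
  have "prob {\<omega> \<in> space M. \<beta> n * d 0 \<omega> < s} / \<alpha> n \<le> prob {\<omega> \<in> space M. \<beta> n * d 0 \<omega> < t} / \<alpha> n" for n
    using assms \<alpha>_pos[of n] by (intro divide_right_mono finite_measure_mono) auto
  then show "\<exists>m. \<forall>n\<ge>m. prob {\<omega> \<in> space M. \<beta> n * d 0 \<omega> < s} / \<alpha> n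
    \<le> prob {\<omega> \<in> space M. \<beta> n * d 0 \<omega> < t} / \<alpha> n"
    by blast
qed (use assms in auto)

lemma cell_weight_nonneg: "b > 0 \<Longrightarrow> j \<ge> 1 \<Longrightarrow> cell_weight b j \<ge> 0"
  unfolding cell_weight_def using \<Lambda>_mono by (simp add: divide_right_mono)

lemma nn_integral_height_intensity_grid_cell:
  assumes "a > 0" "b > 0" "snd k \<ge> 1"
  shows "(\<integral>\<^sup>+z\<in>grid_cell a b k. ennreal (height_intensity z) \<partial>lborel)
    = ennreal (cell_weight b (snd k) / real a)"
proof -
  have "(\<integral>\<^sup>+z\<in>grid_cell a b k. ennreal (height_intensity z) \<partial>lborel)
    = ennreal ((real_of_int (fst k) + 1) / real a - real_of_int (fst k) / real a)
      * ennreal (cell_weight b (snd k))"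
    using assms unfolding grid_cell_eq_Times[OF assms(1,2)] case_prod_beta
    by (subst nn_integral_Times_snd) (auto simp: g_integral cell_weight_def divide_right_mono)
  also have "(real_of_int (fst k) + 1) / real a - real_of_int (fst k) / real a = 1 / real a"
    by (simp add: add_divide_distrib)
  finally show ?thesis
    using cell_weight_nonneg[OF assms(2,3)] by (simp flip: ennreal_mult)
qed

lemma intensity_grid_cell:
  assumes "a > 0" "b > 0" "snd k \<ge> 1"
  shows "intensity height_intensity (grid_cell a b k) = cell_weight b (snd k) / real a"
  unfolding intensity_def nn_integral_height_intensity_grid_cell[OF assms]
  using cell_weight_nonneg assms by simp

lemma intensity_UN_grid_cells:
  assumes "a > 0" "b > 0" "finite A" "\<And>k. k \<in> A \<Longrightarrow> snd k \<ge> 1"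
  shows "intensity height_intensity (\<Union>k\<in>A. grid_cell a b k)
    = (\<Sum>k\<in>A. intensity height_intensity (grid_cell a b k))"
proof (rule intensity_UN[OF _ \<open>finite A\<close> disjoint_grid_cell sets_grid_cell])
  show "height_intensity \<in> borel_measurable borel"
    unfolding borel_prod[symmetric] by measurable
qed (use assms in \<open>simp add: nn_integral_height_intensity_grid_cell\<close>)

lemma intensity_strip:
  assumes "a > 0" "b > 0" "K > 0" "snd k \<ge> 1" "k' \<in> refine_idx K 1 k"
  shows "intensity height_intensity (grid_cell (a * K) b k')
    = intensity height_intensity (grid_cell a b k) / real K"
proof -
  have "snd k' = snd k"
    using assms(5) by (auto simp: refine_idx_def)
  then show ?thesis
    using assms by (simp add: intensity_grid_cell)
qed

lemma prob_scaled_d_in_Ico: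
  assumes "s \<le> t"
  shows "prob {\<omega> \<in> space M. \<beta> n * d x \<omega> \<in> {s..<t}}
    = prob {\<omega> \<in> space M. \<beta> n * d 0 \<omega> < t} - prob {\<omega> \<in> space M. \<beta> n * d 0 \<omega> < s}"
proof -
  have "prob {\<omega> \<in> space M. \<beta> n * d x \<omega> \<in> {s..<t}} = prob {\<omega> \<in> space M. \<beta> n * d 0 \<omega> \<in> {s..<t}}"
    using prob_d_stationary[of "{y. \<beta> n * y \<in> {s..<t}}" x] by simp
  also have "{\<omega> \<in> space M. \<beta> n * d 0 \<omega> \<in> {s..<t}}
      = {\<omega> \<in> space M. \<beta> n * d 0 \<omega> < t} - {\<omega> \<in> space M. \<beta> n * d 0 \<omega> < s}"
    by auto
  also have "prob \<dots> = prob {\<omega> \<in> space M. \<beta> n * d 0 \<omega> < t} - prob {\<omega> \<in> space M. \<beta> n * d 0 \<omega> < s}"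
    using assms by (intro finite_measure_Diff) auto
  finally show ?thesis .
qed

lemma tendsto_mean_grid_cell:
  assumes "a > 0" "b > 0" "snd k \<ge> 1"
  shows "(\<lambda>n. \<integral>\<^sup>+\<omega>. emeasure (pp (\<alpha> n) (\<beta> n) \<omega>) (grid_cell a b k) \<partial>M)
    \<longlonglongrightarrow> ennreal (intensity height_intensity (grid_cell a b k))"
proof -
  let ?s = "real_of_int (snd k) / real b" and ?t = "(real_of_int (snd k) + 1) / real b"
  let ?v = "real_of_int (fst k) / real a" and ?w = "(real_of_int (fst k) + 1) / real a"
  let ?P = "\<lambda>n t. prob {\<omega> \<in> space M. \<beta> n * d 0 \<omega> < t}"
  have st: "0 < ?s" "?s \<le> ?t"
    using assms by (auto simp: divide_right_mono)
  have mean: "(\<integral>\<^sup>+\<omega>. emeasure (pp (\<alpha> n) (\<beta> n) \<omega>) (grid_cell a b k) \<partial>M)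
    = ennreal ((\<alpha> n * real (card (sites (\<alpha> n) ?v ?w))) * (?P n ?t / \<alpha> n - ?P n ?s / \<alpha> n))" for n
  proof -
    have "prob {\<omega> \<in> space M. (\<alpha> n * real_of_int x, \<beta> n * d x \<omega>) \<in> grid_cell a b k}
      = ?P n ?t - ?P n ?s" if "x \<in> sites (\<alpha> n) ?v ?w" for x
      using that prob_scaled_d_in_Ico[OF st(2), of n x]
      by (simp add: grid_cell_eq_Times[OF assms(1,2)] sites_def)
    then show ?thesis
      unfolding nn_integral_emeasure_pp[OF \<alpha>_pos sets_grid_cell grid_cell_subset[OF assms]]
      using \<alpha>_pos[of n] by (simp add: right_diff_distrib)
  qed
  have "(\<lambda>n. (\<alpha> n * real (card (sites (\<alpha> n) ?v ?w))) * (?P n ?t / \<alpha> n - ?P n ?s / \<alpha> n))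
    \<longlonglongrightarrow> (?w - ?v) * (\<Lambda> ?t - \<Lambda> ?s)"
    using st less_le_trans[OF st]
    by (intro tendsto_mult tendsto_diff tail tendsto_scaled_card_sites \<alpha>_pos \<alpha>_tendsto_0)
      (auto simp: divide_right_mono)
  also have "(?w - ?v) * (\<Lambda> ?t - \<Lambda> ?s) = intensity height_intensity (grid_cell a b k)"
    by (simp add: intensity_grid_cell[OF assms] cell_weight_def add_divide_distrib)
  finally show ?thesis
    unfolding mean by (rule tendsto_ennrealI)
qed

lemma tendsto_mean_UN_grid_cells:
  assumes "a > 0" "b > 0" "finite A" "\<And>k. k \<in> A \<Longrightarrow> snd k \<ge> 1"
  shows "(\<lambda>n. \<integral>\<^sup>+\<omega>. emeasure (pp (\<alpha> n) (\<beta> n) \<omega>) (\<Union>k\<in>A. grid_cell a b k) \<partial>M)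
    \<longlonglongrightarrow> ennreal (intensity height_intensity (\<Union>k\<in>A. grid_cell a b k))"
proof -
  have mean: "(\<integral>\<^sup>+\<omega>. emeasure (pp (\<alpha> n) (\<beta> n) \<omega>) (\<Union>k\<in>A. grid_cell a b k) \<partial>M)
    = (\<Sum>k\<in>A. \<integral>\<^sup>+\<omega>. emeasure (pp (\<alpha> n) (\<beta> n) \<omega>) (grid_cell a b k) \<partial>M)" for n
  proof -
    have "emeasure (pp (\<alpha> n) (\<beta> n) \<omega>) (\<Union>k\<in>A. grid_cell a b k)
      = (\<Sum>k\<in>A. emeasure (pp (\<alpha> n) (\<beta> n) \<omega>) (grid_cell a b k))" for \<omega>
      using \<open>finite A\<close> disjoint_grid_cell
      by (intro sum_emeasure[symmetric]) (auto simp: scaled_pp_def)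
    then show ?thesis
      using assms random_LFmeasure.emeasure_X_measurable[OF pp_random_LFmeasure[OF \<alpha>_pos]]
      by (simp add: nn_integral_sum)
  qed
  have limit: "ennreal (intensity height_intensity (\<Union>k\<in>A. grid_cell a b k))
    = (\<Sum>k\<in>A. ennreal (intensity height_intensity (grid_cell a b k)))"
    using intensity_UN_grid_cells[OF assms] by (simp add: sum_ennreal)
  show ?thesis
    unfolding mean limit using assms by (intro tendsto_sum tendsto_mean_grid_cell) auto
qed

lemma tendsto_void_approximation_error:
  assumes "v \<le> w" "t > 0" "(\<lambda>n. s n / \<alpha> n) \<longlonglongrightarrow> 0"
  shows "(\<lambda>n. real (card (sites (\<alpha> n) v w))
    * (s n + 2 * (prob {\<omega> \<in> space M. \<beta> n * d 0 \<omega> < t})\<^sup>2)) \<longlonglongrightarrow> 0"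
proof -
  let ?P = "\<lambda>n. prob {\<omega> \<in> space M. \<beta> n * d 0 \<omega> < t}"
  have "(\<lambda>n. (\<alpha> n * real (card (sites (\<alpha> n) v w))) * (s n / \<alpha> n + 2 * ((?P n / \<alpha> n)\<^sup>2 * \<alpha> n)))
    \<longlonglongrightarrow> (w - v) * (0 + 2 * ((\<Lambda> t)\<^sup>2 * 0))"
    using assms
    by (intro tendsto_intros tail tendsto_scaled_card_sites \<alpha>_pos \<alpha>_tendsto_0)
  moreover have "(\<alpha> n * real (card (sites (\<alpha> n) v w))) * (s n / \<alpha> n + 2 * ((?P n / \<alpha> n)\<^sup>2 * \<alpha> n))
    = real (card (sites (\<alpha> n) v w)) * (s n + 2 * (?P n)\<^sup>2)" for n
    using \<alpha>_pos[of n] by (simp add: power2_eq_square field_simps)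
  ultimately show ?thesis
    by simp
qed

lemma tendsto_void_UN_grid_cells:
  assumes "a > 0" "b > 0" "finite A" "\<And>k. k \<in> A \<Longrightarrow> snd k \<ge> 1"
  shows "(\<lambda>n. prob {\<omega> \<in> space M. emeasure (pp (\<alpha> n) (\<beta> n) \<omega>) (\<Union>k\<in>A. grid_cell a b k) = 0})
    \<longlonglongrightarrow> exp (- intensity height_intensity (\<Union>k\<in>A. grid_cell a b k))"
proof -
  let ?C = "\<Union>k\<in>A. grid_cell a b k"
  let ?void = "\<lambda>n. prob {\<omega> \<in> space M. emeasure (pp (\<alpha> n) (\<beta> n) \<omega>) ?C = 0}"
  let ?mean = "\<lambda>n. enn2real (\<integral>\<^sup>+\<omega>. emeasure (pp (\<alpha> n) (\<beta> n) \<omega>) ?C \<partial>M)"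
  have C: "Ebounded ?C"
    using assms by (intro Ebounded_UN Ebounded_grid_cell)
  then obtain r where r: "?C \<subseteq> dyadic_box r"
    unfolding Ebounded_def using compact_subset_dyadic_box by (meson order_trans)
  have C_subset: "?C \<in> sets borel" "?C \<subseteq> Espace" "?C \<subseteq> {- real r..<real r} \<times> {..<real (Suc r)}"
    using C r by (auto simp: Ebounded_def dyadic_box_def)
  obtain s where s: "(\<lambda>n. s n / \<alpha> n) \<longlonglongrightarrow> 0" "\<And>n x. prob {\<omega> \<in> space M.
      \<beta> n * d x \<omega> < real (Suc r) \<and> \<beta> n * d (x + 1) \<omega> < real (Suc r)} \<le> s n"
    using cluster[of "real (Suc r)"] by auto
  have "(\<lambda>n. ?void n - exp (- ?mean n)) \<longlonglongrightarrow> 0"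
  proof (rule Lim_null_comparison)
    show "(\<lambda>n. real (card (sites (\<alpha> n) (- real r) (real r)))
      * (s n + 2 * (prob {\<omega> \<in> space M. \<beta> n * d 0 \<omega> < real (Suc r)})\<^sup>2)) \<longlonglongrightarrow> 0"
      using s(1) by (intro tendsto_void_approximation_error) auto
    show "\<forall>\<^sub>F n in sequentially. norm (?void n - exp (- ?mean n))
      \<le> real (card (sites (\<alpha> n) (- real r) (real r)))
        * (s n + 2 * (prob {\<omega> \<in> space M. \<beta> n * d 0 \<omega> < real (Suc r)})\<^sup>2)"
      unfolding real_norm_def
      by (intro always_eventually allI prob_pp_void_approx_exp[OF \<alpha>_pos C_subset s(2) refl])
  qed
  moreover have "(\<lambda>n. exp (- ?mean n)) \<longlonglongrightarrow> exp (- intensity height_intensity ?C)"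
    by (intro tendsto_intros tendsto_mean_UN_grid_cells intensity_nonneg assms)
  ultimately have "(\<lambda>n. (?void n - exp (- ?mean n)) + exp (- ?mean n))
    \<longlonglongrightarrow> 0 + exp (- intensity height_intensity ?C)"
    by (rule tendsto_add)
  then show ?thesis
    by simp
qed

theorem pp_vague_convergence:
  assumes "poisson_process N Y height_intensity"
  shows "conv_distr_vague M (\<lambda>n. pp (\<alpha> n) (\<beta> n)) N Y"
proof -
  interpret poisson_convergence M "\<lambda>n. pp (\<alpha> n) (\<beta> n)" N Y height_intensity
    by (intro poisson_convergence.intro pp_random_LFmeasure \<alpha>_pos assms
        emeasure_scaled_pp_grid_cell_Nats intensity_strip tendsto_mean_grid_cell
        tendsto_void_UN_grid_cells)
  show ?thesis
    by (rule vague_convergence)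
qed

end

section \<open>Integrals over a simplex\<close>

lemma nn_integral_powr_Ioo:
  fixes a C t :: real
  assumes "a > -1" "C \<ge> 0" "t > 0"
  shows "(\<integral>\<^sup>+v\<in>{0<..<t}. ennreal (C * v powr a) \<partial>lborel) = ennreal (C * (t powr (a + 1) / (a + 1)))"
proof (rule nn_integral_has_integral_lebesgue')
  have "((\<lambda>v. C * v powr a) has_integral C * (t powr (a + 1) / (a + 1))) {0..t}"
    using assms by (intro has_integral_mult_right has_integral_powr_from_0) auto
  then show "((\<lambda>v. C * v powr a) has_integral C * (t powr (a + 1) / (a + 1))) {0<..<t}"
    by (simp only: has_integral_Icc_iff_Ioo)
qed (use assms in auto)

lemma nn_integral_powr_Ico:
  fixes a C s t :: real
  assumes a: "a > -1" and C: "C \<ge> 0" and st: "0 < s" "s \<le> t"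
  shows "(\<integral>\<^sup>+y\<in>{s..<t}. ennreal (C * y powr a) \<partial>lborel)
    = ennreal (C * t powr (a + 1) / (a + 1) - C * s powr (a + 1) / (a + 1))"
proof -
  have "(\<integral>\<^sup>+y\<in>{s..<t}. ennreal (C * y powr a) \<partial>lborel)
    = (\<integral>\<^sup>+y\<in>{s..t}. ennreal (C * y powr a) \<partial>lborel)"
    using AE_lborel_singleton[of t]
    by (intro nn_integral_cong_AE, elim eventually_mono) (auto simp: indicator_def)
  also have "\<dots> = ennreal (C * t powr (a + 1) / (a + 1) - C * s powr (a + 1) / (a + 1))"
  proof (rule nn_integral_FTC_Icc)
    fix y assume "y \<in> {s..t}"
    then have "((\<lambda>y. C * y powr (a + 1) / (a + 1)) has_real_derivative
        C * ((a + 1) * y powr (a + 1 - 1)) / (a + 1)) (at y)"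
      using st by (intro DERIV_cdivide DERIV_cmult has_real_derivative_powr) auto
    then show "((\<lambda>y. C * y powr (a + 1) / (a + 1)) has_real_derivative C * y powr a) (at y)"
      using a by simp
  qed (use st C in auto)
  finally show ?thesis .
qed

lemma nn_integral_Beta_scaled:
  fixes a b C e :: real
  assumes a: "a > -1" and b: "b > -1" and C: "C \<ge> 0" and e: "e > 0"
  shows "(\<integral>\<^sup>+u\<in>{0<..<e}. ennreal (C * (u powr a * (e - u) powr b)) \<partial>lborel)
    = ennreal (C * (e powr (a + b + 1) * Beta (a + 1) (b + 1)))"
proof -
  let ?f = "\<lambda>u. ennreal (C * (u powr a * (e - u) powr b)) * indicator {0<..<e} u"
  let ?K = "C * e powr (a + b)"
  have rescaled: "?f (0 + e * x)
    = ennreal ?K * (ennreal (x powr a * (1 - x) powr b) * indicator {0<..<1} x)" for x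
  proof (cases "x \<in> {0<..<1}")
    case True
    have "e - e * x = e * (1 - x)"
      by (simp add: algebra_simps)
    then have "(e * x) powr a * (e - e * x) powr b = e powr (a + b) * (x powr a * (1 - x) powr b)"
      using True e by (simp add: powr_mult powr_add)
    then show ?thesis
      using True C e by (simp add: mult.assoc flip: ennreal_mult')
  next
    case False
    then have "0 + e * x \<notin> {0<..<e}"
      using e by (auto simp: zero_less_mult_iff)
    then show ?thesis
      using False by simp
  qed
  have "((\<lambda>x. x powr (a + 1 - 1) * (1 - x) powr (b + 1 - 1)) has_integral Beta (a + 1) (b + 1))
    {0<..<1}"
    using has_integral_Beta_real[of "a + 1" "b + 1"] a b by (simp only: has_integral_Icc_iff_Ioo)
  then have Beta: "(\<integral>\<^sup>+x\<in>{0<..<1}. ennreal (x powr a * (1 - x) powr b) \<partial>lborel)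
    = ennreal (Beta (a + 1) (b + 1))"
    by (intro nn_integral_has_integral_lebesgue') auto
  have "(\<integral>\<^sup>+u. ?f u \<partial>lborel) = ennreal \<bar>e\<bar> * (\<integral>\<^sup>+x. ?f (0 + e * x) \<partial>lborel)"
    using e by (intro nn_integral_real_affine) auto
  also have "\<dots> = ennreal \<bar>e\<bar> * (ennreal ?K * ennreal (Beta (a + 1) (b + 1)))"
    unfolding rescaled Beta[symmetric] by (subst nn_integral_cmult) auto
  also have "\<dots> = ennreal (\<bar>e\<bar> * (?K * Beta (a + 1) (b + 1)))"
    using C by (simp flip: ennreal_mult')
  also have "\<bar>e\<bar> * (?K * Beta (a + 1) (b + 1)) = C * (e powr (a + b + 1) * Beta (a + 1) (b + 1))"
    using e powr_add[of e "a + b" 1] by simp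
  finally show ?thesis .
qed

definition simplex_integral :: "(real \<Rightarrow> ennreal) \<Rightarrow> (real \<Rightarrow> ennreal) \<Rightarrow> real \<Rightarrow> ennreal" where
  "simplex_integral f g e = (\<integral>\<^sup>+u\<in>{0<..<e}. f u * (\<integral>\<^sup>+v\<in>{0<..<e - u}. g v \<partial>lborel) \<partial>lborel)"

lemma simplex_integral_mono:
  assumes "\<And>u. u \<in> {0<..<e} \<Longrightarrow> f u \<le> f' u" "\<And>v. v \<in> {0<..<e} \<Longrightarrow> g v \<le> g' v"
  shows "simplex_integral f g e \<le> simplex_integral f' g' e"
  unfolding simplex_integral_def
proof (intro nn_integral_mono)
  fix u :: real
  have "(\<integral>\<^sup>+v\<in>{0<..<e - u}. g v \<partial>lborel) \<le> (\<integral>\<^sup>+v\<in>{0<..<e - u}. g' v \<partial>lborel)" if "u \<in> {0<..<e}"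
    using that assms(2) by (intro nn_integral_mono) (auto simp: indicator_def)
  then show "f u * (\<integral>\<^sup>+v\<in>{0<..<e - u}. g v \<partial>lborel) * indicator {0<..<e} u
    \<le> f' u * (\<integral>\<^sup>+v\<in>{0<..<e - u}. g' v \<partial>lborel) * indicator {0<..<e} u"
    using assms(1) by (auto simp: indicator_def intro: mult_mono)
qed

lemma simplex_integral_powr:
  fixes a b C D e :: real
  assumes a: "a > -1" and b: "b > -1" and CD: "C \<ge> 0" "D \<ge> 0" and e: "e > 0"
  shows "simplex_integral (\<lambda>u. ennreal (C * u powr a)) (\<lambda>v. ennreal (D * v powr b)) e
    = ennreal (C * D * e powr (a + b + 2) * Beta (a + 1) (b + 1) / (a + b + 2))"
proof -
  have "simplex_integral (\<lambda>u. ennreal (C * u powr a)) (\<lambda>v. ennreal (D * v powr b)) e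
    = (\<integral>\<^sup>+u\<in>{0<..<e}. ennreal (C * D / (b + 1) * (u powr a * (e - u) powr (b + 1))) \<partial>lborel)"
    unfolding simplex_integral_def
  proof (intro nn_integral_cong)
    fix u :: real
    show "ennreal (C * u powr a) * (\<integral>\<^sup>+v\<in>{0<..<e - u}. ennreal (D * v powr b) \<partial>lborel)
        * indicator {0<..<e} u
      = ennreal (C * D / (b + 1) * (u powr a * (e - u) powr (b + 1))) * indicator {0<..<e} u"
    proof (cases "u \<in> {0<..<e}")
      case True
      then show ?thesis
        using b CD by (simp add: nn_integral_powr_Ioo mult_ac flip: ennreal_mult')
    qed simp
  qed
  also have "\<dots> = ennreal (C * D / (b + 1) * (e powr (a + (b + 1) + 1) * Beta (a + 1) (b + 1 + 1)))"
    using a b CD e by (intro nn_integral_Beta_scaled) auto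
  also have "C * D / (b + 1) * (e powr (a + (b + 1) + 1) * Beta (a + 1) (b + 1 + 1))
    = C * D * e powr (a + b + 2) * (Beta (a + 1) (b + 1 + 1) / (b + 1))"
    by (simp add: add.assoc)
  also have "Beta (a + 1) (b + 1 + 1) / (b + 1) = Beta (a + 1) (b + 1) / (a + b + 2)"
  proof -
    have "b + 1 \<notin> \<int>\<^sub>\<le>\<^sub>0"
      using b by (auto elim!: nonpos_Ints_cases)
    from Beta_plus1_right[OF this, of "a + 1"] show ?thesis
      using a b by (simp add: field_simps)
  qed
  finally show ?thesis
    by simp
qed

lemma (in prob_space) emeasure_indep_sum_less:
  fixes U V :: "'a \<Rightarrow> real"
  assumes U: "distributed M lborel U f" and V: "distributed M lborel V g"
    and indep: "indep_var lborel U lborel V"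
    and pos: "\<And>u. u \<le> 0 \<Longrightarrow> f u = 0" "\<And>v. v \<le> 0 \<Longrightarrow> g v = 0"
  shows "emeasure M {\<omega> \<in> space M. U \<omega> + V \<omega> < e} = simplex_integral f g e"
proof -
  have [measurable]: "f \<in> borel_measurable borel" "g \<in> borel_measurable borel"
    using distributed_borel_measurable[OF U] distributed_borel_measurable[OF V] by auto
  let ?A = "{z :: real \<times> real. fst z + snd z < e}"
  have "{z \<in> space (borel \<Otimes>\<^sub>M borel). fst z + snd z < e} \<in> sets (borel \<Otimes>\<^sub>M (borel :: real measure))"
    by measurable
  then have A: "?A \<in> sets (lborel \<Otimes>\<^sub>M lborel)"
    by (simp add: borel_prod lborel_prod)
  have joint: "distributed M (lborel \<Otimes>\<^sub>M lborel) (\<lambda>\<omega>. (U \<omega>, V \<omega>)) (\<lambda>(u, v). f u * g v)"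
    by (intro distributed_joint_indep U V indep lborel.sigma_finite_measure_axioms)
  have "{\<omega> \<in> space M. U \<omega> + V \<omega> < e} = (\<lambda>\<omega>. (U \<omega>, V \<omega>)) -` ?A \<inter> space M"
    by auto
  then have "emeasure M {\<omega> \<in> space M. U \<omega> + V \<omega> < e}
    = (\<integral>\<^sup>+z. (case z of (u, v) \<Rightarrow> f u * g v) * indicator ?A z \<partial>(lborel \<Otimes>\<^sub>M lborel))"
    using distributed_emeasure[OF joint A] by simp
  also have "\<dots> = (\<integral>\<^sup>+u. \<integral>\<^sup>+v. f u * g v * indicator ?A (u, v) \<partial>lborel \<partial>lborel)"
    using A by (subst lborel.nn_integral_fst[symmetric]) auto
  also have "\<dots> = (\<integral>\<^sup>+u. f u * indicator {0<..<e} u * (\<integral>\<^sup>+v\<in>{0<..<e - u}. g v \<partial>lborel) \<partial>lborel)"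
  proof (rule nn_integral_cong)
    fix u
    have "f u * g v * indicator ?A (u, v)
      = f u * indicator {0<..<e} u * (g v * indicator {0<..<e - u} v)" for v
      using pos(1)[of u] pos(2)[of v] by (auto simp: indicator_def not_less)
    then show "(\<integral>\<^sup>+v. f u * g v * indicator ?A (u, v) \<partial>lborel)
      = f u * indicator {0<..<e} u * (\<integral>\<^sup>+v\<in>{0<..<e - u}. g v \<partial>lborel)"
      by (simp add: nn_integral_cmult)
  qed
  finally show ?thesis
    by (simp add: simplex_integral_def mult_ac)
qed

section \<open>The discrepancy at the edge\<close>

lemma tendsto_if_eventually_between:
  fixes f :: "'b \<Rightarrow> real" and h :: "real \<Rightarrow> real"
  assumes "isCont h 0" "r > 0"
    and between: "\<And>\<delta>. 0 < \<delta> \<Longrightarrow> \<delta> < r \<Longrightarrow> \<forall>\<^sub>F x in F. h (- \<delta>) \<le> f x \<and> f x \<le> h \<delta>"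
  shows "(f \<longlongrightarrow> h 0) F"
proof (rule tendstoI)
  fix \<epsilon> :: real assume "\<epsilon> > 0"
  then obtain s where s: "s > 0" "\<And>\<delta>. \<bar>\<delta>\<bar> < s \<Longrightarrow> \<bar>h \<delta> - h 0\<bar> < \<epsilon>"
    using assms(1) unfolding continuous_at_eps_delta dist_real_def by (metis diff_zero)
  define \<delta> where "\<delta> = min r s / 2"
  have \<delta>: "0 < \<delta>" "\<delta> < r" "\<delta> < s"
    using s(1) assms(2) by (auto simp: \<delta>_def)
  have "\<bar>h \<delta> - h 0\<bar> < \<epsilon>" "\<bar>h (- \<delta>) - h 0\<bar> < \<epsilon>"
    using \<delta> by (auto intro!: s(2))
  then show "\<forall>\<^sub>F x in F. dist (f x) (h 0) < \<epsilon>"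
    using between[OF \<delta>(1,2)] by (auto simp: dist_real_def elim!: eventually_mono)
qed

lemma tendsto_Suc_powr_neg: "s < 0 \<Longrightarrow> (\<lambda>n. real (Suc n) powr s) \<longlonglongrightarrow> 0"
  by (rule LIMSEQ_Suc[OF tendsto_neg_powr[OF _ filterlim_real_sequentially]])

locale edge_disorder = prob_space M for M :: "'a measure" +
  fixes F :: "int \<Rightarrow> 'a \<Rightarrow> real" and \<rho> :: "real \<Rightarrow> real" and c q \<kappa> :: real
  assumes c_pos: "c > 0" and q_pos: "q > 0" and kappa: "\<kappa> > -1"
    and rho_even: "\<And>t. \<rho> (- t) = \<rho> t"
    and rho_zero: "\<And>t. t \<notin> {-c<..<c} \<Longrightarrow> \<rho> t = 0"
    and rho_edge: "((\<lambda>t. \<rho> t / \<bar>c - t\<bar> powr \<kappa>) \<longlongrightarrow> q) (at_left c)"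
    and F_indep: "indep_vars (\<lambda>_. borel) F UNIV"
    and F_distr: "\<And>x. distributed M lborel (F x) (\<lambda>t. ennreal (\<rho> t))"
begin

lemma F_measurable [measurable]: "F x \<in> borel_measurable M"
  using distributed_measurable[OF F_distr[of x]] by simp

lemma F_blocks_indep:
  "A \<inter> B = {} \<Longrightarrow> indep_var (PiM A (\<lambda>_. borel)) (\<lambda>\<omega>. \<lambda>i\<in>A. F i \<omega>)
    (PiM B (\<lambda>_. borel)) (\<lambda>\<omega>. \<lambda>i\<in>B. F i \<omega>)"
  by (rule indep_var_restrict[OF F_indep]) auto

lemma F_indep_pair:
  assumes "x \<noteq> y"
  shows "indep_var lborel (F x) lborel (F y)"
proof -
  have "indep_var (PiM {x} (\<lambda>_. borel)) (\<lambda>\<omega>. \<lambda>i\<in>{x}. F i \<omega>)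
    (PiM {y} (\<lambda>_. borel)) (\<lambda>\<omega>. \<lambda>i\<in>{y}. F i \<omega>)"
    using assms by (intro F_blocks_indep) simp
  from indep_var_compose[OF this, of "\<lambda>f. f x" lborel "\<lambda>f. f y" lborel] show ?thesis
    by (simp add: comp_def measurable_component_singleton)
qed

definition edge_density :: "real \<Rightarrow> ennreal" where
  "edge_density u = ennreal (\<rho> (c - u))"

lemma lower_edge_distance_distributed: "distributed M lborel (\<lambda>\<omega>. c + F x \<omega>) edge_density"
proof -
  have "\<rho> (u - c) = \<rho> (c - u)" for u
    using rho_even[of "c - u"] by simp
  then show ?thesis
    using distributed_affine[OF F_distr[of x], of 1 c]
    by (simp add: edge_density_def[abs_def] divide_ennreal_def)
qed

lemma upper_edge_distance_distributed: "distributed M lborel (\<lambda>\<omega>. c - F x \<omega>) edge_density"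
  using distributed_affine[OF F_distr[of x], of "-1" c]
  by (simp add: edge_density_def[abs_def] divide_ennreal_def)

lemma emeasure_F_diff_greater:
  assumes "x \<noteq> y"
  shows "emeasure M {\<omega> \<in> space M. F y \<omega> - F x \<omega> > 2 * c - e}
    = simplex_integral edge_density edge_density e"
proof -
  have "indep_var lborel ((\<lambda>t. c + t) \<circ> F x) lborel ((\<lambda>t. c - t) \<circ> F y)"
    by (rule indep_var_compose[OF F_indep_pair[OF assms]]) auto
  then have "indep_var lborel (\<lambda>\<omega>. c + F x \<omega>) lborel (\<lambda>\<omega>. c - F y \<omega>)"
    by (simp add: comp_def)
  from emeasure_indep_sum_less[OF lower_edge_distance_distributed
      upper_edge_distance_distributed this]
  have "emeasure M {\<omega> \<in> space M. (c + F x \<omega>) + (c - F y \<omega>) < e}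
    = simplex_integral edge_density edge_density e"
    using rho_zero by (simp add: edge_density_def)
  moreover have "(c + F x \<omega>) + (c - F y \<omega>) < e \<longleftrightarrow> F y \<omega> - F x \<omega> > 2 * c - e" for \<omega>
    by auto
  ultimately show ?thesis
    by simp
qed

lemma discrepancy_measurable [measurable]: "(\<lambda>\<omega>. discrepancy c F \<omega> x) \<in> borel_measurable M"
  unfolding discrepancy_def by measurable

lemma emeasure_discrepancy_less:
  assumes "e \<le> 2 * c"
  shows "emeasure M {\<omega> \<in> space M. discrepancy c F \<omega> x < e}
    = 2 * simplex_integral edge_density edge_density e"
proof -
  let ?up = "{\<omega> \<in> space M. F (x + 1) \<omega> - F x \<omega> > 2 * c - e}"
    and ?down = "{\<omega> \<in> space M. F x \<omega> - F (x + 1) \<omega> > 2 * c - e}"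
  have "{\<omega> \<in> space M. discrepancy c F \<omega> x < e} = ?up \<union> ?down"
    by (auto simp: discrepancy_def)
  moreover have "emeasure M (?up \<union> ?down) = emeasure M ?up + emeasure M ?down"
    using assms by (intro plus_emeasure[symmetric]) auto
  moreover have "emeasure M ?up = simplex_integral edge_density edge_density e"
    "emeasure M ?down = simplex_integral edge_density edge_density e"
    by (rule emeasure_F_diff_greater; simp)+
  ultimately show ?thesis
    by (simp only: mult_2)
qed

lemma edge_density_bounds:
  assumes "\<delta> > 0"
  shows "\<exists>\<eta>>0. \<forall>u\<in>{0<..<\<eta>}. ennreal ((q - \<delta>) * u powr \<kappa>) \<le> edge_density u
    \<and> edge_density u \<le> ennreal ((q + \<delta>) * u powr \<kappa>)"
proof -
  have "\<forall>\<^sub>F t in at_left c. dist (\<rho> t / \<bar>c - t\<bar> powr \<kappa>) q < \<delta>"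
    using rho_edge assms by (rule tendstoD)
  then obtain b where b: "b < c" "\<And>t. b < t \<Longrightarrow> t < c \<Longrightarrow> dist (\<rho> t / \<bar>c - t\<bar> powr \<kappa>) q < \<delta>"
    unfolding eventually_at_left_field by auto
  have "(q - \<delta>) * u powr \<kappa> \<le> \<rho> (c - u) \<and> \<rho> (c - u) \<le> (q + \<delta>) * u powr \<kappa>" if "u \<in> {0<..<c - b}" for u
  proof -
    have "\<bar>\<rho> (c - u) / u powr \<kappa> - q\<bar> < \<delta>"
      using b(2)[of "c - u"] that by (simp add: dist_real_def)
    then have "q - \<delta> \<le> \<rho> (c - u) / u powr \<kappa>" "\<rho> (c - u) / u powr \<kappa> \<le> q + \<delta>"
      by linarith+
    then show ?thesis
      using that by (simp add: field_simps)
  qed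
  then show ?thesis
    using b(1) by (intro exI[of _ "c - b"]) (auto simp: edge_density_def intro!: ennreal_leI)
qed

definition tail_const :: real where
  "tail_const = q\<^sup>2 * (2 * Beta (\<kappa> + 1) (\<kappa> + 1)) / (2 * \<kappa> + 2)"

lemma Beta_kappa_pos: "Beta (\<kappa> + 1) (\<kappa> + 1) > 0"
  using kappa unfolding Beta_def by (intro divide_pos_pos mult_pos_pos Gamma_real_pos) auto

lemma eventually_prob_discrepancy_bounds:
  fixes x :: int and \<delta> :: real
  defines "h \<equiv> \<lambda>\<delta>. (q + \<delta>)\<^sup>2 * (2 * Beta (\<kappa> + 1) (\<kappa> + 1)) / (2 * \<kappa> + 2)"
  assumes \<delta>: "0 < \<delta>" "\<delta> < q"
  shows "\<forall>\<^sub>F e in at_right 0.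
    h (- \<delta>) \<le> prob {\<omega> \<in> space M. discrepancy c F \<omega> x < e} / e powr (2 * \<kappa> + 2) \<and>
    prob {\<omega> \<in> space M. discrepancy c F \<omega> x < e} / e powr (2 * \<kappa> + 2) \<le> h \<delta>"
proof -
  obtain \<eta> where \<eta>: "\<eta> > 0" and bounds:
    "\<And>u. u \<in> {0<..<\<eta>} \<Longrightarrow> ennreal ((q - \<delta>) * u powr \<kappa>) \<le> edge_density u"
    "\<And>u. u \<in> {0<..<\<eta>} \<Longrightarrow> edge_density u \<le> ennreal ((q + \<delta>) * u powr \<kappa>)"
    using edge_density_bounds[OF \<delta>(1)] by blast
  have "\<forall>\<^sub>F e in at_right 0. e \<in> {0<..<min \<eta> (2 * c)}"
    using \<eta> c_pos by (intro eventually_at_right_real) auto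
  then show ?thesis
  proof eventually_elim
    case (elim e)
    let ?S = "simplex_integral edge_density edge_density e"
    have powr: "2 * simplex_integral (\<lambda>u. ennreal (C * u powr \<kappa>)) (\<lambda>u. ennreal (C * u powr \<kappa>)) e
      = ennreal (C\<^sup>2 * (2 * Beta (\<kappa> + 1) (\<kappa> + 1)) / (2 * \<kappa> + 2) * e powr (2 * \<kappa> + 2))"
      if "C \<ge> 0" for C
      using elim kappa that Beta_kappa_pos
      by (simp add: simplex_integral_powr power2_eq_square mult_ac
          flip: ennreal_numeral ennreal_mult')
    have prob: "ennreal (prob {\<omega> \<in> space M. discrepancy c F \<omega> x < e}) = 2 * ?S"
      using emeasure_discrepancy_less[of e x] elim by (simp add: emeasure_eq_measure)
    have "2 * simplex_integral (\<lambda>u. ennreal ((q - \<delta>) * u powr \<kappa>)) (\<lambda>u. ennreal ((q - \<delta>) * u powr \<kappa>)) e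
      \<le> 2 * ?S"
      using elim bounds(1) by (intro mult_left_mono simplex_integral_mono) auto
    then have "ennreal (h (- \<delta>) * e powr (2 * \<kappa> + 2)) \<le> 2 * ?S"
      using powr[of "q - \<delta>"] \<delta> by (simp add: h_def)
    moreover have "2 * ?S
      \<le> 2 * simplex_integral (\<lambda>u. ennreal ((q + \<delta>) * u powr \<kappa>)) (\<lambda>u. ennreal ((q + \<delta>) * u powr \<kappa>)) e"
      using elim bounds(2) by (intro mult_left_mono simplex_integral_mono) auto
    then have "2 * ?S \<le> ennreal (h \<delta> * e powr (2 * \<kappa> + 2))"
      using powr[of "q + \<delta>"] \<delta> by (simp add: h_def)
    moreover have "h \<delta> * e powr (2 * \<kappa> + 2) \<ge> 0"
      using Beta_kappa_pos kappa unfolding h_def by simp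
    ultimately show ?case
      unfolding prob[symmetric] using elim by (simp add: field_simps)
  qed
qed

lemma prob_discrepancy_asymp:
  "((\<lambda>e. prob {\<omega> \<in> space M. discrepancy c F \<omega> x < e} / e powr (2 * \<kappa> + 2)) \<longlongrightarrow> tail_const) (at_right 0)"
proof -
  let ?h = "\<lambda>\<delta>. (q + \<delta>)\<^sup>2 * (2 * Beta (\<kappa> + 1) (\<kappa> + 1)) / (2 * \<kappa> + 2)"
  have "isCont ?h 0"
    using kappa by (intro continuous_intros) auto
  from tendsto_if_eventually_between[OF this q_pos eventually_prob_discrepancy_bounds] show ?thesis
    by (simp add: tail_const_def)
qed

lemma AE_abs_F_less: "AE \<omega> in M. \<bar>F x \<omega>\<bar> < c"
proof -
  have "\<bar>t\<bar> < c" if "\<rho> t > 0" for t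
    using rho_zero[of t] that by (cases "t \<in> {-c<..<c}") auto
  then show ?thesis
    by (subst distributed_AE2[OF F_distr]) auto
qed

lemma prob_abs_F_near_edge: "((\<lambda>e. prob {\<omega> \<in> space M. \<bar>F x \<omega>\<bar> > c - e}) \<longlongrightarrow> 0) (at_right 0)"
proof -
  let ?D = "distr M borel (\<lambda>\<omega>. c - \<bar>F x \<omega>\<bar>)"
  interpret D: real_distribution ?D
    by (intro real_distribution_distr) measurable
  have cdf: "cdf ?D e = prob {\<omega> \<in> space M. c - \<bar>F x \<omega>\<bar> \<le> e}" for e
    unfolding cdf_def2 by (subst measure_distr) (auto intro!: arg_cong[where f = prob])
  have "cdf ?D 0 = 0"
    unfolding cdf using AE_abs_F_less[of x] by (subst prob_eq_0) auto
  then have "(cdf ?D \<longlongrightarrow> 0) (at_right 0)"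
    using D.cdf_is_right_cont[of 0] by (simp add: continuous_within)
  then show ?thesis
  proof (rule tendsto_sandwich[OF _ _ tendsto_const, rotated -1])
    show "\<forall>\<^sub>F e in at_right 0. prob {\<omega> \<in> space M. \<bar>F x \<omega>\<bar> > c - e} \<le> cdf ?D e"
      unfolding cdf by (intro always_eventually allI finite_measure_mono) auto
  qed auto
qed

end

section \<open>The discrepancies as a one-dependent sequence\<close>

context edge_disorder
begin

lemma discrepancy_stationary:
  "distr M borel (\<lambda>\<omega>. discrepancy c F \<omega> x) = distr M borel (\<lambda>\<omega>. discrepancy c F \<omega> 0)"
proof -
  let ?h = "\<lambda>(s, t). 2 * c - \<bar>t - s\<bar> :: real"
  have h: "?h \<in> borel_measurable (lborel \<Otimes>\<^sub>M lborel)"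
    by measurable
  have joint: "distributed M (lborel \<Otimes>\<^sub>M lborel) (\<lambda>\<omega>. (F y \<omega>, F (y + 1) \<omega>))
      (\<lambda>(s, t). ennreal (\<rho> s) * ennreal (\<rho> t))" for y
    by (intro distributed_joint_indep F_distr F_indep_pair lborel.sigma_finite_measure_axioms) simp
  have "distr M borel (\<lambda>\<omega>. discrepancy c F \<omega> y)
    = distr (density (lborel \<Otimes>\<^sub>M lborel) (\<lambda>(s, t). ennreal (\<rho> s) * ennreal (\<rho> t))) borel ?h" for y
    unfolding distributed_distr_eq_density[OF joint[of y], symmetric]
    using h distributed_measurable[OF joint[of y]]
    by (subst distr_distr) (simp_all add: comp_def discrepancy_def)
  then show ?thesis
    by metis
qed

lemma discrepancy_one_dependent:
  "indep_var (PiM {..x} (\<lambda>_. borel)) (\<lambda>\<omega>. \<lambda>y\<in>{..x}. discrepancy c F \<omega> y)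
    (PiM {x + 2..} (\<lambda>_. borel)) (\<lambda>\<omega>. \<lambda>y\<in>{x + 2..}. discrepancy c F \<omega> y)"
proof -
  define diffs where "diffs A f = (\<lambda>y\<in>A. 2 * c - \<bar>f (y + 1) - f y\<bar>)" for A and f :: "int \<Rightarrow> real"
  have diffs: "diffs A \<in> measurable (PiM B (\<lambda>_. borel)) (PiM A (\<lambda>_. borel))"
    if "\<And>y. y \<in> A \<Longrightarrow> y \<in> B \<and> y + 1 \<in> B" for A B
    unfolding diffs_def using that by (intro measurable_restrict) measurable
  have "indep_var (PiM {..x} (\<lambda>_. borel)) (diffs {..x} \<circ> (\<lambda>\<omega>. \<lambda>i\<in>{..x + 1}. F i \<omega>))
    (PiM {x + 2..} (\<lambda>_. borel)) (diffs {x + 2..} \<circ> (\<lambda>\<omega>. \<lambda>i\<in>{x + 2..}. F i \<omega>))"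
    by (rule indep_var_compose[OF F_blocks_indep diffs diffs]) auto
  moreover have "diffs {..x} \<circ> (\<lambda>\<omega>. \<lambda>i\<in>{..x + 1}. F i \<omega>) = (\<lambda>\<omega>. \<lambda>y\<in>{..x}. discrepancy c F \<omega> y)"
    "diffs {x + 2..} \<circ> (\<lambda>\<omega>. \<lambda>i\<in>{x + 2..}. F i \<omega>) = (\<lambda>\<omega>. \<lambda>y\<in>{x + 2..}. discrepancy c F \<omega> y)"
    by (auto simp: diffs_def discrepancy_def fun_eq_iff)
  ultimately show ?thesis
    by simp
qed

sublocale discrepancy: one_dependent_sequence M "\<lambda>x \<omega>. discrepancy c F \<omega> x"
  by unfold_locales (rule discrepancy_measurable discrepancy_stationary discrepancy_one_dependent)+

lemma prob_discrepancy_stationary: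
  "prob {\<omega> \<in> space M. discrepancy c F \<omega> x < e} = prob {\<omega> \<in> space M. discrepancy c F \<omega> 0 < e}"
  using discrepancy.prob_d_stationary[of "{..<e}" x] by simp

lemma prob_abs_F_stationary:
  "prob {\<omega> \<in> space M. \<bar>F x \<omega>\<bar> > c - e} = prob {\<omega> \<in> space M. \<bar>F 0 \<omega>\<bar> > c - e}"
proof -
  have "prob {\<omega> \<in> space M. \<bar>F y \<omega>\<bar> > c - e} = measure (distr M lborel (F y)) {t. \<bar>t\<bar> > c - e}" for y
    by (subst measure_distr) (auto intro!: arg_cong[where f = prob])
  then show ?thesis
    by (simp add: distributed_distr_eq_density[OF F_distr])
qed

lemma discrepancy_indep_F: "indep_var borel (\<lambda>\<omega>. discrepancy c F \<omega> x) borel (F (x + 2))"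
proof -
  have "indep_var borel ((\<lambda>f. 2 * c - \<bar>f (x + 1) - f x\<bar>) \<circ> (\<lambda>\<omega>. \<lambda>i\<in>{x, x + 1}. F i \<omega>))
    borel ((\<lambda>f. f (x + 2)) \<circ> (\<lambda>\<omega>. \<lambda>i\<in>{x + 2}. F i \<omega>))"
    by (rule indep_var_compose[OF F_blocks_indep]) auto
  then show ?thesis
    by (simp add: comp_def discrepancy_def)
qed

text \<open>Two neighbouring small discrepancies force both outer values to the edges, and one of these is
  independent of the other discrepancy.\<close>

lemma prob_adjacent_discrepancies_le:
  "prob {\<omega> \<in> space M. discrepancy c F \<omega> x < e \<and> discrepancy c F \<omega> (x + 1) < e}
    \<le> prob {\<omega> \<in> space M. discrepancy c F \<omega> 0 < e} * prob {\<omega> \<in> space M. \<bar>F 0 \<omega>\<bar> > c - e}"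
proof -
  let ?small = "{..<e}" and ?edge = "{t. \<bar>t\<bar> > c - e}"
  have "prob {\<omega> \<in> space M. discrepancy c F \<omega> x < e \<and> discrepancy c F \<omega> (x + 1) < e}
    \<le> prob {\<omega> \<in> space M. discrepancy c F \<omega> x < e \<and> \<bar>F (x + 2) \<omega>\<bar> > c - e}"
  proof (rule finite_measure_mono_AE)
    show "AE \<omega> in M. \<omega> \<in> {\<omega> \<in> space M. discrepancy c F \<omega> x < e \<and> discrepancy c F \<omega> (x + 1) < e}
      \<longrightarrow> \<omega> \<in> {\<omega> \<in> space M. discrepancy c F \<omega> x < e \<and> \<bar>F (x + 2) \<omega>\<bar> > c - e}"
      using AE_abs_F_less[of "x + 1"]
    proof eventually_elim
      case (elim \<omega>)
      then have "\<bar>F (x + 2) \<omega>\<bar> > c - e" if "discrepancy c F \<omega> (x + 1) < e"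
        using that by (simp add: discrepancy_def add.assoc)
      then show ?case
        by auto
    qed
  qed measurable
  also have "\<dots> = prob ((\<lambda>\<omega>. (discrepancy c F \<omega> x, F (x + 2) \<omega>)) -` (?small \<times> ?edge) \<inter> space M)"
    by (auto intro!: arg_cong[where f = prob])
  also have "\<dots> = prob ((\<lambda>\<omega>. discrepancy c F \<omega> x) -` ?small \<inter> space M)
    * prob (F (x + 2) -` ?edge \<inter> space M)"
    by (rule indep_varD[OF discrepancy_indep_F]) auto
  also have "\<dots> = prob {\<omega> \<in> space M. discrepancy c F \<omega> x < e}
    * prob {\<omega> \<in> space M. \<bar>F (x + 2) \<omega>\<bar> > c - e}"
    by (simp add: vimage_def Int_def conj_commute)
  finally show ?thesis
    unfolding prob_discrepancy_stationary[where x = x] prob_abs_F_stationary[where x = "x + 2"] .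
qed

section \<open>Rescaling\<close>

abbreviation \<zeta> :: real where
  "\<zeta> \<equiv> (2 * \<kappa> + 2) / (2 * \<kappa> + 3)"

text \<open>The index is shifted by one because both scales vanish at index zero, where
  \<^term>\<open>(0 :: real) powr y\<close> is zero for every \<^term>\<open>y\<close>.\<close>

definition space_scale :: "nat \<Rightarrow> real" where
  "space_scale n = real (Suc n) powr (- \<zeta>)"

definition height_scale :: "nat \<Rightarrow> real" where
  "height_scale n = real (Suc n) powr (1 - \<zeta>)"

lemma scale_pos: "space_scale n > 0" "height_scale n > 0"
  by (simp_all add: space_scale_def height_scale_def)

lemma height_scale_powr: "height_scale n powr (2 * \<kappa> + 2) = 1 / space_scale n"
proof -
  have "(1 - \<zeta>) * (2 * \<kappa> + 2) = \<zeta>"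
    using kappa by (simp add: field_simps)
  then show ?thesis
    unfolding space_scale_def height_scale_def by (simp add: powr_powr powr_minus_divide)
qed

lemma space_scale_tendsto_0: "space_scale \<longlonglongrightarrow> 0"
  unfolding space_scale_def[abs_def] using kappa by (intro tendsto_Suc_powr_neg) simp

lemma height_threshold_tendsto:
  assumes "t > 0"
  shows "filterlim (\<lambda>n. t / height_scale n) (at_right 0) sequentially"
proof (rule tendsto_imp_filterlim_at_right)
  have "(\<lambda>n. t * real (Suc n) powr (- (1 - \<zeta>))) \<longlonglongrightarrow> t * 0"
    using kappa by (intro tendsto_mult_left tendsto_Suc_powr_neg) (simp add: field_simps)
  then show "(\<lambda>n. t / height_scale n) \<longlonglongrightarrow> 0"
    unfolding height_scale_def powr_minus_divide by simp
qed (use assms scale_pos in auto)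

lemma prob_discrepancy_scaled_tendsto:
  assumes t: "t > 0"
  shows "(\<lambda>n. prob {\<omega> \<in> space M. discrepancy c F \<omega> x < t / height_scale n} / space_scale n)
    \<longlonglongrightarrow> tail_const * t powr (2 * \<kappa> + 2)"
proof -
  let ?P = "\<lambda>n. prob {\<omega> \<in> space M. discrepancy c F \<omega> x < t / height_scale n}"
  have "(\<lambda>n. ?P n / (t / height_scale n) powr (2 * \<kappa> + 2) * t powr (2 * \<kappa> + 2))
    \<longlonglongrightarrow> tail_const * t powr (2 * \<kappa> + 2)"
    by (intro tendsto_mult_right t
        filterlim_compose[OF prob_discrepancy_asymp height_threshold_tendsto])
  moreover have "?P n / (t / height_scale n) powr (2 * \<kappa> + 2) * t powr (2 * \<kappa> + 2)
    = ?P n / space_scale n" for n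
    using t scale_pos[of n] by (simp add: powr_divide height_scale_powr)
  ultimately show ?thesis
    by simp
qed

lemma prob_adjacent_discrepancies_scaled:
  assumes t: "t > 0"
  shows "\<exists>s. (\<lambda>n. s n / space_scale n) \<longlonglongrightarrow> 0 \<and> (\<forall>n x. prob {\<omega> \<in> space M.
    height_scale n * discrepancy c F \<omega> x < t \<and> height_scale n * discrepancy c F \<omega> (x + 1) < t} \<le> s n)"
proof (intro exI conjI allI)
  let ?P = "\<lambda>n. prob {\<omega> \<in> space M. discrepancy c F \<omega> 0 < t / height_scale n}"
    and ?Q = "\<lambda>n. prob {\<omega> \<in> space M. \<bar>F 0 \<omega>\<bar> > c - t / height_scale n}"
  have "(\<lambda>n. ?P n / space_scale n * ?Q n) \<longlonglongrightarrow> tail_const * t powr (2 * \<kappa> + 2) * 0"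
    by (intro tendsto_mult prob_discrepancy_scaled_tendsto t
        filterlim_compose[OF prob_abs_F_near_edge height_threshold_tendsto])
  then show "(\<lambda>n. ?P n * ?Q n / space_scale n) \<longlonglongrightarrow> 0"
    by simp
  show "prob {\<omega> \<in> space M. height_scale n * discrepancy c F \<omega> x < t
      \<and> height_scale n * discrepancy c F \<omega> (x + 1) < t} \<le> ?P n * ?Q n" for n x
    using prob_adjacent_discrepancies_le[of x "t / height_scale n"] scale_pos(2)[of n]
    by (simp add: pos_less_divide_eq mult.commute)
qed

lemma discrepancy_scheme:
  "one_dependent_scheme M (\<lambda>x \<omega>. discrepancy c F \<omega> x) space_scale height_scale
    (\<lambda>t. tail_const * t powr (2 * \<kappa> + 2))
    (\<lambda>y. q\<^sup>2 * (2 * Beta (\<kappa> + 1) (\<kappa> + 1)) * y powr (2 * \<kappa> + 1))"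
proof
  show "(\<lambda>n. prob {\<omega> \<in> space M. height_scale n * discrepancy c F \<omega> 0 < t} / space_scale n)
    \<longlonglongrightarrow> tail_const * t powr (2 * \<kappa> + 2)" if "t > 0" for t
    using prob_discrepancy_scaled_tendsto[OF that, of 0] scale_pos(2)
    by (simp add: pos_less_divide_eq mult.commute)
  show "(\<integral>\<^sup>+y\<in>{s..<t}. ennreal (q\<^sup>2 * (2 * Beta (\<kappa> + 1) (\<kappa> + 1)) * y powr (2 * \<kappa> + 1)) \<partial>lborel)
    = ennreal (tail_const * t powr (2 * \<kappa> + 2) - tail_const * s powr (2 * \<kappa> + 2))"
    if "0 < s" "s \<le> t" for s t
    using that kappa Beta_kappa_pos
    by (subst nn_integral_powr_Ico) (simp_all add: tail_const_def add.commute)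
qed (use scale_pos space_scale_tendsto_0 prob_adjacent_discrepancies_scaled in auto)

end

section \<open>The limit theorem\<close>

theorem theorem2p5:
  fixes M :: "'a measure" and F :: "int \<Rightarrow> 'a \<Rightarrow> real"
    and N :: "'b measure" and mu :: "'b \<Rightarrow> (real \<times> real) measure"
    and \<rho> :: "real \<Rightarrow> real" and c q \<kappa> :: real
  assumes c_pos: "c > 0" and q_pos: "q > 0" and kappa: "\<kappa> > -1"
    and rho_even: "\<And>t. \<rho> (- t) = \<rho> t"
    and rho_cont: "continuous_on {-c<..<c} \<rho>"
    and rho_pos: "\<And>t. t \<in> {-c<..<c} \<Longrightarrow> \<rho> t > 0"
    and rho_zero: "\<And>t. t \<notin> {-c<..<c} \<Longrightarrow> \<rho> t = 0"
    and rho_edge: "((\<lambda>t. \<rho> t / \<bar>c - t\<bar> powr \<kappa>) \<longlongrightarrow> q) (at_left c)"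
    and M: "prob_space M"
    and F_indep: "prob_space.indep_vars M (\<lambda>_. borel) F UNIV"
    and F_distr: "\<And>x. distributed M lborel (F x) (\<lambda>t. ennreal (\<rho> t))"
    and mu_poisson: "poisson_process N mu
        (\<lambda>(x, y). q\<^sup>2 * (2 * Beta (\<kappa> + 1) (\<kappa> + 1)) * y powr (2 * \<kappa> + 1))"
  shows "conv_distr_vague M
           (rescaled_pp c ((2 * \<kappa> + 2) / (2 * \<kappa> + 3)) F) N mu"
proof (rule conv_distr_vague_if_Suc)
  interpret edge_disorder M F \<rho> c q \<kappa>
    by (intro edge_disorder.intro M edge_disorder_axioms.intro)
      (fact c_pos q_pos kappa rho_even rho_zero rho_edge F_indep F_distr)+
  have "rescaled_pp c \<zeta> F (Suc n) = discrepancy.pp (space_scale n) (height_scale n)" for n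
    by (simp add: fun_eq_iff rescaled_pp_def scaled_pp_def space_scale_def height_scale_def)
  then show "conv_distr_vague M (\<lambda>n. rescaled_pp c \<zeta> F (Suc n)) N mu"
    using one_dependent_scheme.pp_vague_convergence[OF discrepancy_scheme mu_poisson] by simp
qed

end
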